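(* Let $D$ be a division ring, and let $G$ be an ascendant subgroup of the multiplicative group $D^*$. If $G$ is periodic, then $G$ is central, i.e. $G$ is contained in the center of $D$.
   Context: $D^*=D\setminus\{0\}$. A subgroup $H$ of a group $X$ is ascendant in $X$ if there is an ordinal $\gamma$ and a family of subgroups $(H_\alpha)_{\alpha\le\gamma}$ with $H_0=H$, $H_\gamma=X$, $H_\alpha\trianglelefteq H_{\alpha+1}$ for all $\alpha<\gamma$, and $H_\lambda=\bigcup_{\alpha<\lambda}H_\alpha$ for every limit ordinal $\lambda\le\gamma$. A group is periodic if each of its elements has finite order. *)

theory Defs
  imports "HOL-Algebra.Coset"
begin

definition nonzero_group :: "'a::division_ring monoid"
  where "nonzero_group = \<lparr>carrier = UNIV - {0}, monoid.mult = (*), one = 1\<rparr>"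

lemma group_nonzero_group: "group (nonzero_group :: 'a::division_ring monoid)"
proof (rule groupI)
  fix x :: 'a
  assume "x \<in> carrier nonzero_group"
  then show "\<exists>y\<in>carrier nonzero_group. y \<otimes>\<^bsub>nonzero_group\<^esub> x = \<one>\<^bsub>nonzero_group\<^esub>"
    by (intro bexI[of _ "inverse x"]) (auto simp: nonzero_group_def)
qed (auto simp: nonzero_group_def mult.assoc)

definition ring_center :: "'a::division_ring set"
  where "ring_center = {z. \<forall>x. z * x = x * z}"

definition periodic :: "('a, 'b) monoid_scheme \<Rightarrow> bool"
  where "periodic X \<longleftrightarrow> (\<forall>x\<in>carrier X. \<exists>n::nat. n > 0 \<and> x [^]\<^bsub>X\<^esub> n = \<one>\<^bsub>X\<^esub>)"

text \<open>
  The ordinals \<open>\<alpha> \<le> \<gamma>\<close> are represented by the initial segment \<open>{..\<gamma>}\<close> of an arbitrary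
  well-ordered type: \<open>LEAST \<alpha>. True\<close> is the ordinal 0, and \<open>LEAST \<beta>. \<alpha> < \<beta>\<close> is \<open>\<alpha> + 1\<close>
  (it exists and is at most \<open>\<gamma>\<close> whenever \<open>\<alpha> < \<gamma>\<close>).
\<close>

definition limit_ordinal :: "'i::wellorder \<Rightarrow> bool"
  where "limit_ordinal \<mu> \<longleftrightarrow> (\<exists>\<alpha>. \<alpha> < \<mu>) \<and> (\<forall>\<alpha><\<mu>. \<exists>\<beta>. \<alpha> < \<beta> \<and> \<beta> < \<mu>)"

definition ascendant_series ::
    "('a, 'b) monoid_scheme \<Rightarrow> 'a set \<Rightarrow> 'i::wellorder \<Rightarrow> ('i \<Rightarrow> 'a set) \<Rightarrow> bool"
  where "ascendant_series X H \<gamma> F \<longleftrightarrow>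
    (\<forall>\<alpha>\<le>\<gamma>. subgroup (F \<alpha>) X) \<and>
    F (LEAST \<alpha>. True) = H \<and>
    F \<gamma> = carrier X \<and>
    (\<forall>\<alpha><\<gamma>. F \<alpha> \<lhd> X\<lparr>carrier := F (LEAST \<beta>. \<alpha> < \<beta>)\<rparr>) \<and>
    (\<forall>\<mu>\<le>\<gamma>. limit_ordinal \<mu> \<longrightarrow> F \<mu> = (\<Union>\<alpha>\<in>{..<\<mu>}. F \<alpha>))"

text \<open>
  HOL cannot quantify over types inside a definition, so the type supplying the ordinals is a
  parameter. A theorem assuming \<open>ascendant TYPE('i) H X\<close> for a type variable \<open>'i\<close> covers
  series of every ordinal length.
\<close>

definition ascendant :: "'i::wellorder itself \<Rightarrow> 'a set \<Rightarrow> ('a, 'b) monoid_scheme \<Rightarrow> bool"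
  where "ascendant _ H X \<longleftrightarrow> (\<exists>(\<gamma>::'i) F. ascendant_series X H \<gamma> F)"

end

theory Submission
  imports Defs "HOL-Computational_Algebra.Primes"
begin

text \<open>
  The product of all periodic normal subgroups of a group is periodic, and this radical does not
  shrink along an ascending series; so \<open>G\<close> lies in a periodic normal subgroup of \<open>D*\<close>. Let \<open>a\<close> be
  a noncentral element of it. Averaging over powers of \<open>a\<close> gives \<open>y\<close> with
  \<open>y a y\<^sup>-\<^sup>1 = a ^ e \<noteq> a\<close>, and some \<open>y ^ m\<close> commutes with \<open>a\<close>. If \<open>w\<close> is central and not invertible in
  the ring generated by \<open>a\<close> and \<open>y\<close>, then the commutator of \<open>a\<close> and \<open>1 + w y\<close> is a torsion element
  \<open>\<noteq> 1\<close> congruent to \<open>1\<close> modulo \<open>w\<close>, which is impossible for \<open>w = 3\<close> in characteristic \<open>0\<close> (after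
  possibly replacing \<open>y\<close> by \<open>y\<^sup>-\<^sup>1\<close>) and for \<open>w = y ^ m\<close> in characteristic \<open>p\<close> when \<open>y\<close> has infinite
  order. If \<open>y\<close> has finite order in characteristic \<open>p\<close>, then \<open>a\<close> and \<open>y\<close> generate a finite ring,
  which is commutative by Wedderburn's theorem.
\<close>

section \<open>Powers and torsion in division rings\<close>

text \<open>The obstacle is the inverse of \<open>1 + w y\<close>, which need not lie in the ring
  \<open>B\<close> spanned by monomials in \<open>a\<close> and \<open>y\<close> over a central
  coefficient ring \<open>S\<close>. As \<open>y ^ m\<close> is in \<open>S\<close>, a geometric sum
  multiplies \<open>1 + w y\<close> to \<open>1 + w t\<close> with \<open>t\<close> in
  \<open>S\<close>; so it is enough to invert the central set \<open>1 + w S\<close>, which does not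
  make \<open>w\<close> a unit. That \<open>w\<close> is no unit of \<open>B\<close> either is where
  finite spanning over \<open>S\<close> and Nakayama enter. Some power \<open>c\<close> of the
  commutator has prime order \<open>l\<close>, so \<open>1 + c + ... + c ^ (l - 1) = 0\<close>; as
  \<open>c\<close> is 1 modulo \<open>w\<close>, the integer \<open>l\<close> is divisible by
  \<open>w\<close>. A second integer divisible by \<open>w\<close> and coprime to \<open>l\<close>,
  namely the characteristic or 3, is a contradiction. The remaining case \<open>l = w = 3\<close> is
  a quadratic equation that can be divided by 3. The constant is not 2 because
  \<open>-1 = 1 + 2 (-1)\<close> is torsion and congruent to 1 modulo 2.\<close>

lemma power_mult_commuting:
  fixes x y :: "'a::monoid_mult"
  assumes "x * y = y * x"
  shows "(x * y) ^ n = x ^ n * y ^ n"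
proof (induction n)
  case (Suc n)
  have "(x * y) ^ Suc n = x * (y * x ^ n) * y ^ n"
    using Suc by (simp add: mult.assoc)
  also have "y * x ^ n = x ^ n * y"
    using power_commuting_commutes[OF assms] by simp
  finally show ?case by (simp add: mult.assoc)
qed simp

lemma power_mod_order:
  fixes a :: "'a::monoid_mult"
  assumes "a ^ n = 1"
  shows "a ^ (k mod n) = a ^ k"
proof -
  have "a ^ k = a ^ (n * (k div n) + k mod n)" by simp
  also have "\<dots> = a ^ (k mod n)"
    unfolding power_add power_mult using assms by simp
  finally show ?thesis by simp
qed

lemma commute_inverse:
  fixes x y :: "'a::division_ring"
  assumes "x * y = y * x"
  shows "x * inverse y = inverse y * x"
  using mult_commute_imp_mult_inverse_commute[OF assms[symmetric]] by simp

lemma inverse_cancel: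
  fixes x :: "'a::division_ring"
  assumes "x \<noteq> 0"
  shows "x * (inverse x * z) = z" "inverse x * (x * z) = z"
  using assms by (simp_all add: mult.assoc[symmetric])

lemma eq_mult_inverse:
  fixes x y z :: "'a::division_ring"
  assumes "x * y = z" "y \<noteq> 0"
  shows "x = z * inverse y"
  using assms by (auto simp: mult.assoc)

lemma one_minus_mult_geometric_sum:
  fixes c :: "'a::ring_1"
  shows "(1 - c) * (\<Sum>j<n. c ^ j) = 1 - c ^ n"
proof (induction n)
  case (Suc n)
  then show ?case by (simp only: sum.lessThan_Suc distrib_left) (simp add: algebra_simps)
qed simp

lemma geometric_sum_eq_0:
  fixes c :: "'a::division_ring"
  assumes "c ^ n = 1" "c \<noteq> 1"
  shows "(\<Sum>j<n. c ^ j) = 0"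
  using one_minus_mult_geometric_sum[of c n] assms by simp

lemma binomial_one_plus:
  fixes x :: "'a::ring_1"
  shows "(1 + x) ^ n = (\<Sum>k\<le>n. of_nat (n choose k) * x ^ k)"
proof (induction n)
  case (Suc n)
  have "(1 + x) ^ Suc n = (1 + x) ^ n + (1 + x) ^ n * x"
    by (simp add: power_commutes[symmetric] algebra_simps)
  also have "(1 + x) ^ n * x = (\<Sum>k\<le>n. of_nat (n choose k) * x ^ Suc k)"
    unfolding Suc sum_distrib_right by (simp add: mult.assoc power_commutes[symmetric])
  also have "(1 + x) ^ n = (\<Sum>k\<le>Suc n. of_nat (n choose k) * x ^ k)"
    using Suc by (simp add: binomial_eq_0)
  also have "\<dots> = 1 + (\<Sum>k\<le>n. of_nat (n choose Suc k) * x ^ Suc k)"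
    by (subst sum.atMost_Suc_shift) simp
  also have "1 + (\<Sum>k\<le>n. of_nat (n choose Suc k) * x ^ Suc k)
      + (\<Sum>k\<le>n. of_nat (n choose k) * x ^ Suc k)
      = (\<Sum>k\<le>Suc n. of_nat (Suc n choose k) * x ^ k)"
    by (subst sum.atMost_Suc_shift) (simp add: sum.distrib algebra_simps)
  finally show ?case .
qed simp

text \<open>By Frobenius applied to the commuting pair 1 and \<open>c - 1\<close>, the power
  \<open>(c - 1) ^ p\<close> is \<open>c ^ p - 1 = 0\<close>, and a division ring has no
  nilpotents.\<close>

lemma no_torsion_of_char_order:
  fixes c :: "'a::division_ring"
  assumes "prime p" "of_nat p = (0::'a)" "c ^ p = 1"
  shows "c = 1"
proof -
  have p: "p > 0" using assms(1) prime_gt_0_nat by blast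
  have "(1 + (c - 1)) ^ p = (\<Sum>k\<le>p. of_nat (p choose k) * (c - 1) ^ k)"
    by (rule binomial_one_plus)
  also have "\<dots> = (\<Sum>k\<in>{0,p}. of_nat (p choose k) * (c - 1) ^ k)"
  proof (rule sum.mono_neutral_right)
    show "\<forall>k\<in>{..p} - {0, p}. of_nat (p choose k) * (c - 1) ^ k = 0"
    proof
      fix k assume "k \<in> {..p} - {0, p}"
      then have "p dvd (p choose k)"
        using assms(1) by (intro dvd_choose_prime) auto
      then show "of_nat (p choose k) * (c - 1) ^ k = 0"
        using assms(2) by (auto elim!: dvdE)
    qed
  qed auto
  also have "\<dots> = 1 + (c - 1) ^ p" using p by simp
  finally have "(c - 1) ^ p = 0" using assms(3) by simp
  then show ?thesis using p by simp
qed

lemma torsion_prime_power_order: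
  fixes c :: "'a::monoid_mult"
  assumes "c ^ k = 1" "k > 0" "c \<noteq> 1"
  obtains l r where "prime l" "(c ^ r) ^ l = 1" "c ^ r \<noteq> 1"
proof -
  define n where "n = (LEAST n. n > 0 \<and> c ^ n = 1)"
  have n: "n > 0" "c ^ n = 1"
    using LeastI[of "\<lambda>n. n > 0 \<and> c ^ n = 1" k] assms unfolding n_def by auto
  have min: "c ^ j \<noteq> 1" if "0 < j" "j < n" for j
    using not_less_Least[of j "\<lambda>n. n > 0 \<and> c ^ n = 1"] that unfolding n_def by auto
  have "n \<noteq> 1" using n assms(3) by auto
  then obtain l where l: "prime l" "l dvd n" using prime_factor_nat by blast
  then obtain r where r: "n = l * r" by (auto elim: dvdE)
  have "r > 0" "r < n"
    using n(1) prime_gt_1_nat[OF l(1)] unfolding r by auto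
  moreover have "(c ^ r) ^ l = 1"
    using n(2) unfolding r by (metis mult.commute power_mult)
  ultimately show thesis using that l(1) min by blast
qed

text \<open>The last property is what allows averaging over the powers of \<open>a\<close>. If the
  order \<open>n\<close> vanished in the division ring, so would a prime factor \<open>p\<close> of
  it; then \<open>a ^ (n div p)\<close> has trivial \<open>p\<close>-th power, hence is 1, against
  minimality.\<close>

lemma torsion_order:
  fixes a :: "'a::division_ring"
  assumes "a ^ k = 1" "k > 0"
  obtains n where "n > 0" "a ^ n = 1" "\<And>j. 0 < j \<Longrightarrow> j < n \<Longrightarrow> a ^ j \<noteq> 1" "of_nat n \<noteq> (0::'a)"
proof -
  define n where "n = (LEAST n. n > 0 \<and> a ^ n = 1)"
  have n: "n > 0" "a ^ n = 1"
    using LeastI[of "\<lambda>n. n > 0 \<and> a ^ n = 1" k] assms unfolding n_def by auto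
  have min: "a ^ j \<noteq> 1" if "0 < j" "j < n" for j
    using not_less_Least[of j "\<lambda>n. n > 0 \<and> a ^ n = 1"] that unfolding n_def by auto
  have "of_nat n \<noteq> (0::'a)"
  proof
    assume 0: "of_nat n = (0::'a)"
    have "\<exists>p. prime p \<and> p dvd m \<and> of_nat p = (0::'a)" if "m > 0" "of_nat m = (0::'a)" for m :: nat
      using that
    proof (induction m rule: less_induct)
      case (less m)
      then have "m \<noteq> 1" by auto
      then obtain q where q: "prime q" "q dvd m" using prime_factor_nat by blast
      then obtain r where r: "m = q * r" by (auto elim: dvdE)
      show ?case
      proof (cases "of_nat q = (0::'a)")
        case False
        have "r > 0" "r < m" using less.prems(1) prime_gt_1_nat[OF q(1)] unfolding r by auto
        moreover have "of_nat r = (0::'a)" using less(3) r False by auto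
        ultimately show ?thesis using less.IH r by (metis dvd_mult)
      qed (use q in blast)
    qed
    then obtain p where p: "prime p" "p dvd n" "of_nat p = (0::'a)" using n(1) 0 by blast
    then obtain r where r: "n = p * r" by (auto elim: dvdE)
    have "r > 0" "r < n" using n(1) prime_gt_1_nat[OF p(1)] unfolding r by auto
    moreover have "a ^ r = 1"
    proof (rule no_torsion_of_char_order[OF p(1,3)])
      show "(a ^ r) ^ p = 1" using n(2) unfolding r by (metis mult.commute power_mult)
    qed
    ultimately show False using min by blast
  qed
  then show thesis using that n min by blast
qed

lemma torsion_inverse:
  fixes a :: "'a::division_ring"
  assumes "a ^ n = 1" "n > 0"
  shows "inverse a = a ^ (n - 1)"
proof -
  have "a * a ^ (n - 1) = 1" using assms by (simp add: power_Suc[symmetric] del: power_Suc)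
  then show ?thesis by (simp add: inverse_unique)
qed

text \<open>A discrete Fourier decomposition of \<open>x\<close>: each \<open>P j\<close> is an
  eigenvector in the sense \<open>a ^ j * P j * a = P j\<close>, and the \<open>P j\<close> add up
  to \<open>n x\<close>, because the geometric sums over nontrivial powers of \<open>a\<close>
  vanish. If every \<open>P j\<close> commuted with \<open>a\<close>, so would
  \<open>x\<close>.\<close>

lemma normalize_torsion:
  fixes a x :: "'a::division_ring"
  assumes n: "n > 0" "a ^ n = 1" "\<And>j. 0 < j \<Longrightarrow> j < n \<Longrightarrow> a ^ j \<noteq> 1" "of_nat n \<noteq> (0::'a)"
    and x: "x * a \<noteq> a * x"
  obtains y e j where "y = (\<Sum>k<n. a ^ (j * k) * x * a ^ k)" "y * a = a ^ e * y" "y * a \<noteq> a * y"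
proof -
  define P where "P j = (\<Sum>k<n. a ^ (j * k) * x * a ^ k)" for j
  \<comment> \<open>The natural number \<open>(n - 1) * j\<close> stands for \<open>- j\<close>
    modulo \<open>n\<close>.\<close>
  have rel: "P j * a = a ^ ((n - 1) * j) * P j" for j
  proof -
    define f where "f k = a ^ (j * k) * x * a ^ k" for k
    have "f n = f 0"
      unfolding f_def using n(2) by (simp add: mult.commute[of j n] power_mult)
    have "a ^ j * P j * a = (\<Sum>k<n. f (Suc k))"
      unfolding P_def f_def sum_distrib_left sum_distrib_right
      by (intro sum.cong refl) (simp add: power_add mult.assoc power_commutes)
    also have "\<dots> = (\<Sum>k<Suc n. f k) - f 0"
      by (subst sum.lessThan_Suc_shift) simp
    also have "\<dots> = P j" using \<open>f n = f 0\<close> by (simp add: P_def f_def)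
    finally have 1: "a ^ j * P j * a = P j" .
    have 2: "a ^ ((n - 1) * j) * a ^ j = 1"
    proof -
      have "(n - 1) * j + j = n * j" using n(1) by (cases n) auto
      then have "a ^ ((n - 1) * j) * a ^ j = (a ^ n) ^ j"
        unfolding power_add[symmetric] power_mult[symmetric] by (rule arg_cong)
      then show ?thesis using n(2) by simp
    qed
    have "a ^ ((n - 1) * j) * P j = (a ^ ((n - 1) * j) * a ^ j) * P j * a"
      by (subst 1[symmetric]) (simp add: mult.assoc)
    then show ?thesis using 2 by simp
  qed
  have tot: "(\<Sum>j<n. P j) = of_nat n * x"
  proof -
    have "(\<Sum>j<n. P j) = (\<Sum>k<n. (\<Sum>j<n. (a ^ k) ^ j) * x * a ^ k)"
      unfolding P_def sum_distrib_right
      by (subst sum.swap) (simp add: power_mult[symmetric] mult.commute)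
    also have "\<dots> = (\<Sum>k\<in>{0}. (\<Sum>j<n. (a ^ k) ^ j) * x * a ^ k)"
    proof (rule sum.mono_neutral_right)
      show "\<forall>k\<in>{..<n} - {0}. (\<Sum>j<n. (a ^ k) ^ j) * x * a ^ k = 0"
      proof
        fix k assume k: "k \<in> {..<n} - {0}"
        have "(a ^ k) ^ n = 1"
          using n(2) by (metis mult.commute power_mult power_one)
        then have "(\<Sum>j<n. (a ^ k) ^ j) = 0"
          using geometric_sum_eq_0 n(3) k by auto
        then show "(\<Sum>j<n. (a ^ k) ^ j) * x * a ^ k = 0" by simp
      qed
    qed (use n in auto)
    also have "\<dots> = of_nat n * x" by simp
    finally show ?thesis .
  qed
  have "\<exists>j. P j * a \<noteq> a * P j"
  proof (rule ccontr)
    assume "\<nexists>j. P j * a \<noteq> a * P j"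
    then have "(\<Sum>j<n. P j) * a = a * (\<Sum>j<n. P j)"
      by (simp add: sum_distrib_left sum_distrib_right)
    then have "of_nat n * (x * a) = (a * of_nat n) * x"
      unfolding tot by (simp add: mult.assoc)
    then have "of_nat n * (x * a) = of_nat n * (a * x)"
      unfolding mult_of_nat_commute[symmetric] by (simp add: mult.assoc)
    then show False using n(4) x by simp
  qed
  then show thesis using that[OF P_def rel] by blast
qed

lemma conj_power_rel:
  fixes a y :: "'a::monoid_mult"
  assumes "y * a = a ^ e * y"
  shows "y ^ j * a ^ k = a ^ (e ^ j * k) * y ^ j"
proof -
  have 1: "y * a ^ k = a ^ (e * k) * y" for k
  proof (induction k)
    case (Suc k)
    have "y * a ^ Suc k = (y * a) * a ^ k" by (simp add: mult.assoc)
    also have "\<dots> = a ^ e * (y * a ^ k)" unfolding assms by (simp add: mult.assoc)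
    also have "\<dots> = a ^ (e + e * k) * y" unfolding Suc by (simp add: power_add mult.assoc)
    finally show ?case by (simp add: algebra_simps)
  qed simp
  show ?thesis
  proof (induction j)
    case (Suc j)
    have "y ^ Suc j * a ^ k = y * (y ^ j * a ^ k)" by (simp add: mult.assoc)
    also have "\<dots> = (y * a ^ (e ^ j * k)) * y ^ j" unfolding Suc by (simp add: mult.assoc)
    also have "\<dots> = a ^ (e ^ Suc j * k) * y ^ Suc j" unfolding 1 by (simp add: mult.assoc)
    finally show ?case .
  qed simp
qed

text \<open>Pigeonhole: the conjugates \<open>a ^ (e ^ j)\<close> of \<open>a\<close> under powers
  of \<open>y\<close> take at most \<open>n\<close> values. Two equal ones, for
  \<open>i < j\<close>, give \<open>m = j - i\<close> after cancelling \<open>y ^ i\<close>.\<close>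

lemma normalizing_power_commutes:
  fixes a y :: "'a::division_ring"
  assumes "n > 0" "a ^ n = 1" "y * a = a ^ e * y" "y \<noteq> 0"
  obtains m where "m > 0" "y ^ m * a = a * y ^ m"
proof -
  have rel: "y ^ j * a = a ^ (e ^ j) * y ^ j" for j
    using conj_power_rel[OF assms(3), of j 1] by simp
  have "range (\<lambda>j::nat. a ^ (e ^ j)) \<subseteq> (\<lambda>k. a ^ k) ` {..<n}"
  proof
    fix z assume "z \<in> range (\<lambda>j::nat. a ^ (e ^ j))"
    then obtain j where z: "z = a ^ (e ^ j)" by auto
    then have "z = a ^ (e ^ j mod n)" using power_mod_order[OF assms(2)] by simp
    then show "z \<in> (\<lambda>k. a ^ k) ` {..<n}" using assms(1) by auto
  qed
  then have "finite (range (\<lambda>j::nat. a ^ (e ^ j)))" using finite_subset by blast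
  then have "\<not> inj (\<lambda>j::nat. a ^ (e ^ j))" using finite_imageD infinite_UNIV_nat by blast
  then obtain i j where ij: "i < j" "a ^ (e ^ i) = a ^ (e ^ j)"
    unfolding inj_def by (metis linorder_neqE_nat)
  define m where "m = j - i"
  have yj: "y ^ j = y ^ i * y ^ m" using ij by (simp add: m_def power_add[symmetric])
  have "y ^ i * (y ^ m * a) = a ^ (e ^ i) * y ^ i * y ^ m"
    using rel[of j] ij yj by (simp add: mult.assoc)
  also have "\<dots> = y ^ i * (a * y ^ m)" unfolding rel[of i, symmetric] by (simp add: mult.assoc)
  finally have "y ^ m * a = a * y ^ m" using assms(4) by simp
  then show thesis using that[of m] ij by (simp add: m_def)
qed

section \<open>Subrings and finitely spanned modules\<close>

locale unital_subring =
  fixes R :: "'a::ring_1 set"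
  assumes one_mem: "1 \<in> R"
    and diff_mem: "x \<in> R \<Longrightarrow> y \<in> R \<Longrightarrow> x - y \<in> R"
    and mult_mem: "x \<in> R \<Longrightarrow> y \<in> R \<Longrightarrow> x * y \<in> R"
begin

lemma zero_mem: "0 \<in> R"
  using diff_mem[OF one_mem one_mem] by simp

lemma uminus_mem: "x \<in> R \<Longrightarrow> - x \<in> R"
  using diff_mem[OF zero_mem, of x] by simp

lemma add_mem: "x \<in> R \<Longrightarrow> y \<in> R \<Longrightarrow> x + y \<in> R"
  using diff_mem[OF _ uminus_mem, of x y] by simp

lemma power_mem: "x \<in> R \<Longrightarrow> x ^ n \<in> R"
  by (induction n) (auto intro: one_mem mult_mem)

lemma sum_mem: "(\<And>i. i \<in> I \<Longrightarrow> f i \<in> R) \<Longrightarrow> sum f I \<in> R"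
  by (induction I rule: infinite_finite_induct) (auto intro: zero_mem add_mem)

lemma of_nat_mem: "of_nat n \<in> R"
  by (induction n) (auto intro: zero_mem one_mem add_mem)

lemma of_int_mem: "of_int n \<in> R"
  by (cases n rule: int_cases2) (auto intro: of_nat_mem uminus_mem)

end

lemma unital_subring_range_of_int: "unital_subring (range (of_int :: int \<Rightarrow> 'a::ring_1))"
proof
  show "1 \<in> range (of_int :: int \<Rightarrow> 'a)" by (metis of_int_1 rangeI)
next
  fix x y :: 'a
  assume "x \<in> range of_int" "y \<in> range of_int"
  then obtain m n :: int where "x = of_int m" "y = of_int n" by blast
  then have "x - y = of_int (m - n)" "x * y = of_int (m * n)" by simp_all
  then show "x - y \<in> range of_int" "x * y \<in> range of_int" by blast+
qed

text \<open>The generators form an indexed family rather than a set, so monomials that happen to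
  coincide cause no trouble.\<close>

definition gspan :: "'a::ring_1 set \<Rightarrow> ('i \<Rightarrow> 'a) \<Rightarrow> 'i set \<Rightarrow> 'a set"
  where "gspan S g I = {x. \<exists>c. (\<forall>i\<in>I. c i \<in> S) \<and> x = (\<Sum>i\<in>I. c i * g i)}"

lemma finite_gspan:
  assumes "finite S" "finite I"
  shows "finite (gspan S g I)"
proof (rule finite_subset)
  show "gspan S g I \<subseteq> (\<lambda>c. \<Sum>i\<in>I. c i * g i) ` (I \<rightarrow>\<^sub>E S)"
  proof
    fix x assume "x \<in> gspan S g I"
    then obtain c where c: "\<forall>i\<in>I. c i \<in> S" "x = (\<Sum>i\<in>I. c i * g i)"
      unfolding gspan_def by auto
    have "x = (\<Sum>i\<in>I. restrict c I i * g i)"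
      unfolding c(2) by (rule sum.cong) simp_all
    moreover have "restrict c I \<in> I \<rightarrow>\<^sub>E S"
      using c(1) by (intro restrict_PiE_iff[THEN iffD2])
    ultimately show "x \<in> (\<lambda>c. \<Sum>i\<in>I. c i * g i) ` (I \<rightarrow>\<^sub>E S)" by (rule image_eqI)
  qed
  show "finite ((\<lambda>c. \<Sum>i\<in>I. c i * g i) ` (I \<rightarrow>\<^sub>E S))"
    by (intro finite_imageI finite_PiE assms)
qed

context unital_subring
begin

lemma gspan_zero: "0 \<in> gspan R g I"
  unfolding gspan_def using zero_mem by (auto intro!: exI[of _ "\<lambda>_. 0"])

lemma gspan_diff:
  assumes "x \<in> gspan R g I" "y \<in> gspan R g I"
  shows "x - y \<in> gspan R g I"
proof -
  obtain c d where "\<forall>i\<in>I. c i \<in> R" "x = (\<Sum>i\<in>I. c i * g i)"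
    "\<forall>i\<in>I. d i \<in> R" "y = (\<Sum>i\<in>I. d i * g i)"
    using assms unfolding gspan_def by auto
  then show ?thesis
    unfolding gspan_def
    by (auto intro!: exI[of _ "\<lambda>i. c i - d i"] diff_mem simp: sum_subtractf algebra_simps)
qed

lemma gspan_add:
  assumes "x \<in> gspan R g I" "y \<in> gspan R g I"
  shows "x + y \<in> gspan R g I"
  using gspan_diff[OF assms(1) gspan_diff[OF gspan_zero assms(2)]] by simp

lemma gspan_sum: "(\<And>j. j \<in> J \<Longrightarrow> f j \<in> gspan R g I) \<Longrightarrow> sum f J \<in> gspan R g I"
  by (induction J rule: infinite_finite_induct) (auto intro: gspan_zero gspan_add)

lemma gspan_scale:
  assumes "r \<in> R" "x \<in> gspan R g I"
  shows "r * x \<in> gspan R g I"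
proof -
  obtain c where "\<forall>i\<in>I. c i \<in> R" "x = (\<Sum>i\<in>I. c i * g i)"
    using assms unfolding gspan_def by auto
  then show ?thesis
    unfolding gspan_def using assms(1)
    by (auto intro!: exI[of _ "\<lambda>i. r * c i"] mult_mem simp: sum_distrib_left mult.assoc)
qed

lemma gspan_base:
  assumes "finite I" "i \<in> I"
  shows "g i \<in> gspan R g I"
proof -
  have "(\<Sum>j\<in>I. (if j = i then 1 else 0) * g j) = (\<Sum>j\<in>I. if j = i then g j else 0)"
    by (rule sum.cong) auto
  also have "\<dots> = g i" using assms by simp
  finally show ?thesis
    unfolding gspan_def using one_mem zero_mem
    by (intro CollectI exI[of _ "\<lambda>j. if j = i then 1 else 0"]) auto
qed

lemma gspan_left_mult:
  assumes "\<And>r. r \<in> R \<Longrightarrow> t * r = r * t" "\<And>i. i \<in> I \<Longrightarrow> t * g i \<in> gspan R g I"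
    "x \<in> gspan R g I"
  shows "t * x \<in> gspan R g I"
proof -
  obtain c where c: "\<forall>i\<in>I. c i \<in> R" "x = (\<Sum>i\<in>I. c i * g i)"
    using assms(3) unfolding gspan_def by auto
  have "t * x = (\<Sum>i\<in>I. c i * (t * g i))"
    unfolding c(2) sum_distrib_left using c(1) assms(1)
    by (intro sum.cong refl) (simp add: mult.assoc[symmetric])
  also have "\<dots> \<in> gspan R g I"
    using assms(2) c(1) by (auto intro!: gspan_sum gspan_scale[of "c i" "t * g i" for i])
  finally show ?thesis .
qed

text \<open>
  A form of Nakayama's lemma: instead of localizing \<open>R\<close> at \<open>1 + w R\<close>, the denominators
  \<open>1 + w t\<close> are carried along.
\<close>

lemma nakayama:
  fixes g :: "'i \<Rightarrow> 'a"
  assumes comm: "\<And>x y. x \<in> R \<Longrightarrow> y \<in> R \<Longrightarrow> x * y = y * x"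
    and w: "w \<in> R"
    and cancel: "\<And>t x. t \<in> R \<Longrightarrow> (1 + w * t) * x = 0 \<Longrightarrow> x = (0::'a)"
    and "finite I"
    and "\<And>i. i \<in> I \<Longrightarrow> \<exists>t\<in>R. \<exists>z\<in>gspan R g I. (1 + w * t) * g i = w * z"
    and "i \<in> I"
  shows "g i = 0"
  using assms(4-)
proof (induction I arbitrary: i rule: finite_induct)
  case (insert k I)
  let ?G = "gspan R g I"
  have split: "\<exists>d\<in>R. \<exists>u\<in>?G. z = d * g k + u" if z: "z \<in> gspan R g (insert k I)" for z
  proof -
    obtain c where c: "\<forall>i\<in>insert k I. c i \<in> R" "z = (\<Sum>i\<in>insert k I. c i * g i)"
      using z unfolding gspan_def by auto
    then show ?thesis
      using insert(1,2) by (intro bexI[of _ "c k"] bexI[of _ "\<Sum>i\<in>I. c i * g i"]) (auto simp: gspan_def)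
  qed
  obtain t0 z where t0: "t0 \<in> R" "z \<in> gspan R g (insert k I)" "(1 + w * t0) * g k = w * z"
    using insert.prems(1)[of k] by auto
  then obtain d0 u0 where d0: "d0 \<in> R" "u0 \<in> ?G" "z = d0 * g k + u0"
    using split by blast
  \<comment> \<open>The \<open>g k\<close> term of \<open>z\<close> moves to the left-hand side and
    changes the denominator; \<open>g k\<close> is then expressed by the other generators.\<close>
  define s where "s = t0 - d0"
  have s: "s \<in> R" using t0 d0 diff_mem by (simp add: s_def)
  have gk: "(1 + w * s) * g k = w * u0"
    using t0(3) d0(3) by (simp add: s_def algebra_simps)
  have gi: "g i = 0" if "i \<in> I" for i
  proof (rule insert.IH[OF _ that])
    fix i assume "i \<in> I"
    then obtain t z where t: "t \<in> R" "z \<in> gspan R g (insert k I)" "(1 + w * t) * g i = w * z"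
      using insert.prems(1)[of i] by auto
    then obtain d u where d: "d \<in> R" "u \<in> ?G" "z = d * g k + u"
      using split by blast
    let ?e = "1 + w * s"
    have eR: "?e \<in> R" using w s by (intro add_mem one_mem mult_mem)
    \<comment> \<open>Multiplying by the denominator \<open>?e\<close> of \<open>g k\<close> allows
      \<open>g k\<close> to be eliminated. The product of two denominators is again of the form
      \<open>1 + w\<close> times an element of \<open>R\<close>, so the induction hypothesis applies
      to \<open>I\<close>.\<close>
    have "?e * ((1 + w * t) * g i) = ?e * w * d * g k + ?e * w * u"
      unfolding t(3) d(3) by (simp add: algebra_simps)
    also have "?e * w * d = w * d * ?e"
      using comm[OF eR, of "w * d"] w d mult_mem by (simp add: mult.assoc)
    also have "w * d * ?e * g k = w * d * (w * u0)"
      using gk by (simp add: mult.assoc)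
    also have "?e * w = w * ?e" using comm[OF eR w] .
    finally have "?e * ((1 + w * t) * g i) = w * ((d * w) * u0 + ?e * u)"
      by (simp add: algebra_simps)
    moreover have "?e * ((1 + w * t) * g i) = (1 + w * (s + t + s * (w * t))) * g i"
      by (simp add: algebra_simps)
    moreover have "(d * w) * u0 + ?e * u \<in> ?G"
      using d0 d w eR by (intro gspan_add gspan_scale mult_mem)
    moreover have "s + t + s * (w * t) \<in> R"
      using s t w by (intro add_mem mult_mem)
    ultimately show "\<exists>t\<in>R. \<exists>z\<in>?G. (1 + w * t) * g i = w * z" by metis
  qed
  have "u0 = 0" using d0(2) gi by (auto simp: gspan_def)
  then have "g k = 0" using cancel[OF s] gk by simp
  then show ?case using gi insert.prems by auto
qed simp

end

text \<open>In a division ring the cancellation required by \<open>nakayama\<close> only asks for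
  \<open>1 + w * t \<noteq> 0\<close>, and \<open>1 + w * t = 0\<close> would make
  \<open>- t\<close> an inverse of \<open>w\<close> in \<open>S\<close>.\<close>

lemma nakayama_one_notin:
  fixes S :: "'a::division_ring set" and g :: "'i \<Rightarrow> 'a"
  assumes S: "unital_subring S"
    and comm: "\<And>x y. x \<in> S \<Longrightarrow> y \<in> S \<Longrightarrow> x * y = y * x"
    and w: "w \<in> S" "\<And>x. x \<in> S \<Longrightarrow> w * x \<noteq> 1"
    and I: "finite I" "i \<in> I" "g i \<noteq> 0"
    and z: "\<And>i. i \<in> I \<Longrightarrow> \<exists>z\<in>gspan S g I. g i = w * z"
  shows False
proof -
  interpret unital_subring S by fact
  have "g i = 0"
  proof (rule nakayama[OF comm w(1) _ I(1) _ I(2)])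
    fix t x assume t: "t \<in> S" "(1 + w * t) * x = 0"
    have "1 + w * t \<noteq> 0"
      using w(2)[OF uminus_mem[OF t(1)]] by (auto simp: add_eq_0_iff)
    then show "x = 0" using t by simp
  next
    fix i assume "i \<in> I"
    then show "\<exists>t\<in>S. \<exists>z\<in>gspan S g I. (1 + w * t) * g i = w * z"
      using z[of i] by (intro bexI[OF _ zero_mem]) simp
  qed
  then show False using I by blast
qed

section \<open>The subring generated by a torsion element and a normalizing element\<close>

text \<open>The coefficient ring \<open>S\<close> stays abstract because it has two kinds of
  instances: the prime ring, when the characteristic is positive and \<open>y\<close> has finite
  order, and the integer polynomials in \<open>y ^ m\<close> otherwise.\<close>

locale normalized_torsion =
  fixes a y :: "'a::division_ring" and n e m :: nat and S :: "'a set"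
  assumes n: "n > 0" "a ^ n = 1"
    and rel: "y * a = a ^ e * y"
    and m: "m > 0" "y ^ m \<in> S"
    and S: "unital_subring S"
    and S_comm: "\<And>r s. r \<in> S \<Longrightarrow> s \<in> S \<Longrightarrow> r * s = s * r"
    and S_a: "\<And>r. r \<in> S \<Longrightarrow> a * r = r * a"
    and S_y: "\<And>r. r \<in> S \<Longrightarrow> y * r = r * y"
begin

sublocale S: unital_subring S by (rule S)

definition gens :: "nat \<times> nat \<Rightarrow> 'a"
  where "gens p = a ^ fst p * y ^ snd p"

definition idx :: "(nat \<times> nat) set"
  where "idx = {..<n} \<times> {..<m}"

text \<open>This is the whole ring generated by \<open>S\<close>, \<open>a\<close> and
  \<open>y\<close>: the relation \<open>rel\<close> moves powers of \<open>y\<close> to the right,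
  \<open>a ^ n = 1\<close> bounds the first exponent, and \<open>y ^ m\<close> is absorbed into the
  coefficients. Hence \<open>n * m\<close> monomials suffice.\<close>

definition B :: "'a set"
  where "B = gspan S gens idx"

lemma finite_idx: "finite idx"
  by (simp add: idx_def)

lemma monomial_mem: "j < m \<Longrightarrow> a ^ k * y ^ j \<in> B"
proof -
  assume "j < m"
  then have "gens (k mod n, j) \<in> B"
    unfolding B_def using n finite_idx by (intro S.gspan_base) (auto simp: idx_def)
  then show ?thesis using power_mod_order[OF n(2)] by (simp add: gens_def)
qed

lemma S_subset: "r \<in> S \<Longrightarrow> r \<in> B"
  using S.gspan_scale[of r 1 gens idx] monomial_mem[of 0 0] m by (simp add: B_def)

lemma left_a: "x \<in> B \<Longrightarrow> a * x \<in> B"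
  unfolding B_def
proof (rule S.gspan_left_mult)
  fix i assume "i \<in> idx"
  then have "a ^ Suc (fst i) * y ^ snd i \<in> B" by (intro monomial_mem) (auto simp: idx_def)
  then show "a * gens i \<in> gspan S gens idx" by (simp add: B_def gens_def mult.assoc)
qed (use S_a in auto)

lemma left_y: "x \<in> B \<Longrightarrow> y * x \<in> B"
  unfolding B_def
proof (rule S.gspan_left_mult)
  fix p assume "p \<in> idx"
  then have lt: "snd p < m" by (auto simp: idx_def)
  have "y * a ^ fst p = a ^ (e * fst p) * y"
    using conj_power_rel[OF rel, of 1 "fst p"] by simp
  then have eq: "y * gens p = a ^ (e * fst p) * y ^ Suc (snd p)"
    by (simp add: gens_def mult.assoc[symmetric])
  have "y * gens p \<in> B"
  proof (cases "Suc (snd p) < m")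
    case True
    then show ?thesis unfolding eq by (rule monomial_mem)
  next
    case False
    then have "Suc (snd p) = m" using lt by simp
    \<comment> \<open>The exponent of \<open>y\<close> has reached \<open>m\<close>; the overflow
      \<open>y ^ m\<close> becomes a coefficient from \<open>S\<close>.\<close>
    moreover have "a ^ (e * fst p) * y ^ m = y ^ m * (a ^ (e * fst p) * y ^ 0)"
      using power_commuting_commutes[OF S_a[OF m(2)]] by simp
    moreover have "y ^ m * (a ^ (e * fst p) * y ^ 0) \<in> B"
      unfolding B_def using m monomial_mem[of 0 "e * fst p"]
      by (simp add: S.gspan_scale B_def)
    ultimately show ?thesis unfolding eq by simp
  qed
  then show "y * gens p \<in> gspan S gens idx" by (simp add: B_def)
qed (use S_y in auto)

lemma left_power_a: "x \<in> B \<Longrightarrow> a ^ k * x \<in> B"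
  by (induction k) (auto simp: mult.assoc left_a)

lemma left_power_y: "x \<in> B \<Longrightarrow> y ^ k * x \<in> B"
  by (induction k) (auto simp: mult.assoc left_y)

sublocale B: unital_subring B
proof
  show "1 \<in> B" by (rule S_subset[OF S.one_mem])
  show "x - y \<in> B" if "x \<in> B" "y \<in> B" for x y
    using that unfolding B_def by (rule S.gspan_diff)
  show "x * z \<in> B" if "x \<in> B" "z \<in> B" for x z
  proof -
    obtain c where c: "\<forall>i\<in>idx. c i \<in> S" "x = (\<Sum>i\<in>idx. c i * gens i)"
      using \<open>x \<in> B\<close> unfolding B_def gspan_def by auto
    have "x * z = (\<Sum>i\<in>idx. c i * (a ^ fst i * (y ^ snd i * z)))"
      unfolding c(2) sum_distrib_right by (simp add: gens_def mult.assoc)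
    also have "\<dots> \<in> B"
    proof -
      have "a ^ k * (y ^ j * z) \<in> gspan S gens idx" for k j
        using left_power_a[OF left_power_y[OF \<open>z \<in> B\<close>]] by (simp add: B_def)
      then show ?thesis unfolding B_def using c(1)
        by (intro S.gspan_sum S.gspan_scale[of "c i" "a ^ fst i * (y ^ snd i * z)" for i]) auto
    qed
    finally show ?thesis .
  qed
qed

lemma a_mem: "a \<in> B"
  using left_a[OF B.one_mem] by simp

lemma y_mem: "y \<in> B"
  using left_y[OF B.one_mem] by simp

lemma S_central:
  assumes "r \<in> S" "x \<in> B"
  shows "r * x = x * r"
proof -
  obtain c where c: "\<forall>i\<in>idx. c i \<in> S" "x = (\<Sum>i\<in>idx. c i * gens i)"
    using \<open>x \<in> B\<close> unfolding B_def gspan_def by auto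
  have g: "gens i * r = r * gens i" for i
  proof -
    have "gens i * r = a ^ fst i * (y ^ snd i * r)" by (simp add: gens_def mult.assoc)
    also have "\<dots> = (a ^ fst i * r) * y ^ snd i"
      using power_commuting_commutes[OF S_y[OF assms(1)]] by (simp add: mult.assoc)
    also have "\<dots> = r * gens i"
      using power_commuting_commutes[OF S_a[OF assms(1)]] by (simp add: gens_def mult.assoc)
    finally show ?thesis .
  qed
  show ?thesis
    unfolding c(2) sum_distrib_left sum_distrib_right
  proof (rule sum.cong[OF refl])
    fix i assume "i \<in> idx"
    then have "c i * r = r * c i" using c(1) S_comm assms(1) by auto
    then show "r * (c i * gens i) = c i * gens i * r"
      unfolding mult.assoc g by (simp add: mult.assoc[symmetric])
  qed
qed

lemma finite_B: "finite S \<Longrightarrow> finite B"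
  unfolding B_def by (rule finite_gspan[OF _ finite_idx])

end

section \<open>Arithmetic modulo a central nonunit\<close>

locale normalized_torsion_nonunit = normalized_torsion +
  fixes w :: 'a
  assumes w: "w \<in> S" "w \<noteq> 0" "\<And>x. x \<in> S \<Longrightarrow> w * x \<noteq> 1"
begin

text \<open>An inverse \<open>x\<close> of \<open>w\<close> in \<open>B\<close> would write every
  generator as \<open>w * (x * gens i)\<close>, that is, \<open>B = w B\<close>; Nakayama then kills
  all generators, among them \<open>gens (0, 0) = 1\<close>.\<close>

lemma w_nonunit: "x \<in> B \<Longrightarrow> w * x \<noteq> 1"
proof
  assume x: "x \<in> B" "w * x = 1"
  show False
  proof (rule nakayama_one_notin[OF S S_comm w(1,3) finite_idx])
    show "(0, 0) \<in> idx" using n m by (simp add: idx_def)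
    show "gens (0, 0) \<noteq> 0" by (simp add: gens_def)
  next
    fix i assume "i \<in> idx"
    then have "gens i \<in> B" unfolding B_def by (intro S.gspan_base finite_idx)
    then have "x * gens i \<in> gspan S gens idx" using B.mult_mem[OF x(1)] by (simp add: B_def)
    moreover have "gens i = w * (x * gens i)" using x(2) by (simp add: mult.assoc[symmetric])
    ultimately show "\<exists>z\<in>gspan S gens idx. gens i = w * z" by blast
  qed
qed

text \<open>The localization of \<open>B\<close> at the central multiplicative set \<open>1 + w S\<close>.\<close>

definition Loc :: "'a set"
  where "Loc = {x. \<exists>t\<in>S. (1 + w * t) * x \<in> B}"

lemma denom_mem: "t \<in> S \<Longrightarrow> 1 + w * t \<in> S"
  using w by (intro S.add_mem S.one_mem S.mult_mem)

lemma denom_nonzero: "t \<in> S \<Longrightarrow> 1 + w * t \<noteq> 0"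
  using w(3)[OF S.uminus_mem, of t] by (auto simp: add_eq_0_iff)

lemma denom_mult:
  assumes "t \<in> S" "u \<in> S"
  obtains v where "v \<in> S" "(1 + w * t) * (1 + w * u) = 1 + w * v"
proof
  show "t + u + t * (w * u) \<in> S" using assms w by (intro S.add_mem S.mult_mem)
  show "(1 + w * t) * (1 + w * u) = 1 + w * (t + u + t * (w * u))"
    by (simp add: algebra_simps)
qed

lemma Loc_commute:
  assumes "r \<in> S" "x \<in> Loc"
  shows "r * x = x * r"
proof -
  obtain t where t: "t \<in> S" "(1 + w * t) * x \<in> B" using assms(2) by (auto simp: Loc_def)
  have "(1 + w * t) * (r * x) = r * ((1 + w * t) * x)"
    using S_comm[OF denom_mem[OF t(1)] assms(1)] by (simp add: mult.assoc[symmetric])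
  also have "\<dots> = (1 + w * t) * (x * r)"
    using S_central[OF assms(1) t(2)] by (simp add: mult.assoc)
  finally show ?thesis using denom_nonzero[OF t(1)] by simp
qed

lemma B_subset_Loc: "x \<in> B \<Longrightarrow> x \<in> Loc"
  unfolding Loc_def using S.zero_mem by (auto intro!: bexI[of _ 0])

sublocale Loc: unital_subring Loc
proof
  show "1 \<in> Loc" by (rule B_subset_Loc[OF B.one_mem])
  fix x z assume x: "x \<in> Loc" and z: "z \<in> Loc"
  obtain t where t: "t \<in> S" "(1 + w * t) * x \<in> B" using x by (auto simp: Loc_def)
  obtain u where u: "u \<in> S" "(1 + w * u) * z \<in> B" using z by (auto simp: Loc_def)
  obtain v where v: "v \<in> S" "(1 + w * t) * (1 + w * u) = 1 + w * v"
    using denom_mult[OF t(1) u(1)] .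
  have comm: "(1 + w * t) * (1 + w * u) = (1 + w * u) * (1 + w * t)"
    using S_comm[OF denom_mem[OF t(1)] denom_mem[OF u(1)]] .
  have "(1 + w * v) * (x - z) = (1 + w * u) * ((1 + w * t) * x) - (1 + w * t) * ((1 + w * u) * z)"
    unfolding right_diff_distrib mult.assoc[symmetric] v(2) comm[symmetric] ..
  also have "\<dots> \<in> B"
    by (intro B.diff_mem B.mult_mem[OF _ t(2)] B.mult_mem[OF _ u(2)] S_subset denom_mem t(1) u(1))
  finally show "x - z \<in> Loc" unfolding Loc_def using v(1) by blast
  have "(1 + w * v) * (x * z) = (1 + w * t) * (((1 + w * u) * x) * z)"
    unfolding v(2)[symmetric] mult.assoc ..
  also have "(1 + w * u) * x = x * (1 + w * u)"
    using Loc_commute[OF denom_mem[OF u(1)] x] .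
  finally have "(1 + w * v) * (x * z) = ((1 + w * t) * x) * ((1 + w * u) * z)"
    by (simp add: mult.assoc)
  also have "\<dots> \<in> B" by (rule B.mult_mem[OF t(2) u(2)])
  finally show "x * z \<in> Loc" unfolding Loc_def using v(1) by blast
qed

text \<open>Clearing the denominator of an inverse \<open>x\<close> gives
  \<open>w * ((1 + w * t) * x) = 1 + w * t\<close>, so \<open>(1 + w * t) * x - t\<close> would be
  an inverse of \<open>w\<close> already in \<open>B\<close>.\<close>

lemma w_nonunit_Loc: "x \<in> Loc \<Longrightarrow> w * x \<noteq> 1"
proof
  assume x: "x \<in> Loc" "w * x = 1"
  obtain t where t: "t \<in> S" "(1 + w * t) * x \<in> B" using x by (auto simp: Loc_def)
  have "w * ((1 + w * t) * x) = (w * (1 + w * t)) * x" by (simp add: mult.assoc)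
  also have "w * (1 + w * t) = (1 + w * t) * w" using S_comm[OF w(1) denom_mem[OF t(1)]] .
  also have "(1 + w * t) * w * x = 1 + w * t" using x(2) by (simp add: mult.assoc)
  finally have "w * ((1 + w * t) * x - t) = 1" by (simp add: algebra_simps)
  moreover have "(1 + w * t) * x - t \<in> B" using t S_subset by (intro B.diff_mem)
  ultimately show False using w_nonunit by blast
qed

text \<open>The geometric sum \<open>g\<close> of the powers of \<open>- (w * y)\<close> below
  \<open>m\<close> satisfies \<open>(1 + w * y) * g = 1 - (- (w * y)) ^ m\<close>. Since
  \<open>y ^ m\<close> and \<open>w\<close> are in \<open>S\<close> and \<open>m > 0\<close>, the
  right-hand side is an admissible denominator \<open>1 + w * t\<close>.\<close>

lemma inverse_mem_Loc: "inverse (1 + w * y) \<in> Loc" and one_plus_nonzero: "1 + w * y \<noteq> 0"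
proof -
  have wO: "w \<in> B" using S_subset[OF w(1)] .
  show nz: "1 + w * y \<noteq> 0"
    using w_nonunit[OF B.uminus_mem[OF y_mem]] by (auto simp: add_eq_0_iff)
  let ?x = "- (w * y)"
  define g where "g = (\<Sum>j<m. ?x ^ j)"
  have gO: "g \<in> B"
    unfolding g_def using wO y_mem by (intro B.sum_mem B.power_mem B.uminus_mem B.mult_mem)
  obtain k where k: "m = Suc k" using m(1) by (cases m) auto
  have "(1 - ?x) * g = 1 - ?x ^ m"
    unfolding g_def by (rule one_minus_mult_geometric_sum)
  moreover define t where "t = - ((- 1) ^ m * w ^ k * y ^ m)"
  moreover have "?x ^ m = - (w * t)"
  proof -
    have "?x ^ m = (- 1) ^ m * (w * y) ^ m"
      by (rule power_minus)
    also have "(w * y) ^ m = w * (w ^ k * y ^ m)"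
      unfolding power_mult_commuting[OF S_y[OF w(1), symmetric]] by (subst k) (simp add: mult.assoc)
    also have "(- 1) ^ m * (w * (w ^ k * y ^ m)) = w * ((- 1) ^ m * (w ^ k * y ^ m))"
      by (cases "even m") auto
    finally show ?thesis by (simp add: t_def mult.assoc)
  qed
  ultimately have eq: "(1 + w * y) * g = 1 + w * t" by simp
  have t: "t \<in> S"
    unfolding t_def
    by (intro S.uminus_mem S.mult_mem[OF _ m(2)] S.mult_mem S.power_mem[OF w(1)]
        S.power_mem[OF S.uminus_mem[OF S.one_mem]])
  have "(1 + w * t) * (1 + w * y) = (1 + w * y) * (1 + w * t)"
    using denom_mem[OF t] wO y_mem B.one_mem
    by (intro S_central B.add_mem B.mult_mem) auto
  then have "(1 + w * t) * inverse (1 + w * y) = inverse (1 + w * y) * (1 + w * t)"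
    by (rule commute_inverse)
  also have "\<dots> = g" unfolding eq[symmetric] using nz by (simp add: mult.assoc[symmetric])
  finally show "inverse (1 + w * y) \<in> Loc"
    unfolding Loc_def using gO t by auto
qed

text \<open>
  As \<open>w Loc\<close> is a proper ideal, a torsion element congruent to \<open>1\<close> modulo \<open>w\<close> has few
  possible orders.
\<close>

lemma commutator_form:
  assumes "y * a \<noteq> a * y"
  obtains z where "z \<in> Loc" "z \<noteq> 0"
    "a * (1 + w * y) * inverse a * inverse (1 + w * y) = 1 + w * z"
proof
  let ?v = "1 + w * y"
  \<comment> \<open>Found from \<open>a * ?v * inverse a - ?v = w * (a * y * inverse a - y)\<close>,
    which uses that \<open>w\<close> commutes with \<open>a\<close>.\<close>
  let ?z = "(a * y * inverse a - y) * inverse ?v"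
  have a0: "a \<noteq> 0" using n by (auto simp: power_0_left)
  have "inverse a \<in> B"
    using torsion_inverse[OF n(2,1)] B.power_mem[OF a_mem] by simp
  then have "a * y * inverse a - y \<in> B"
    using a_mem y_mem by (intro B.diff_mem B.mult_mem)
  then show "?z \<in> Loc" using inverse_mem_Loc B_subset_Loc by (intro Loc.mult_mem)
  have "a * y * inverse a \<noteq> y"
  proof
    assume *: "a * y * inverse a = y"
    have "a * y = (a * y * inverse a) * a" using a0 by (simp add: mult.assoc)
    then show False using assms unfolding * by simp
  qed
  then show "?z \<noteq> 0" using one_plus_nonzero by simp
  have "a * ?v * inverse a = 1 + (a * w) * y * inverse a"
    using a0 by (simp add: algebra_simps)
  also have "a * w = w * a" using S_a[OF w(1)] .
  also have "1 + w * a * y * inverse a = ?v + w * (a * y * inverse a - y)"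
    by (simp add: algebra_simps)
  finally have "a * ?v * inverse a = ?v + w * (a * y * inverse a - y)" .
  then have "a * ?v * inverse a * inverse ?v = ?v * inverse ?v + w * ?z"
    by (simp only: distrib_right mult.assoc)
  then show "a * ?v * inverse a * inverse ?v = 1 + w * ?z"
    using one_plus_nonzero by simp
qed

lemma power_one_plus:
  assumes "z \<in> Loc"
  shows "\<exists>u\<in>Loc. (1 + w * z) ^ r = 1 + w * u"
proof (induction r)
  case 0
  then show ?case using Loc.zero_mem by (auto intro!: bexI[of _ 0])
next
  case (Suc r)
  then obtain u where u: "u \<in> Loc" "(1 + w * z) ^ r = 1 + w * u" by blast
  have "(1 + w * z) ^ Suc r = 1 + w * (z + u + z * (w * u))"
    using u(2) by (simp add: algebra_simps)
  moreover have "z + u + z * (w * u) \<in> Loc"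
    using assms u B_subset_Loc[OF S_subset[OF w(1)]] by (intro Loc.add_mem Loc.mult_mem)
  ultimately show ?case by blast
qed

text \<open>A power \<open>1 + w * z\<close> of the commutator has prime order \<open>l\<close>. Its
  geometric sum of length \<open>l\<close> vanishes, and each of the \<open>l\<close> summands is 1
  modulo \<open>w Loc\<close>; this puts \<open>l\<close> into \<open>w Loc\<close>.\<close>

lemma torsion_commutator:
  assumes nc: "y * a \<noteq> a * y"
    and tors: "\<And>v. v \<noteq> 0 \<Longrightarrow> \<exists>k>0. (a * v * inverse a * inverse v) ^ k = 1"
  obtains l z u where "prime l" "z \<in> Loc" "z \<noteq> 0" "(1 + w * z) ^ l = 1"
    "u \<in> Loc" "of_nat l = w * u"
proof -
  obtain z0 where z0: "z0 \<in> Loc" "z0 \<noteq> 0"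
    "a * (1 + w * y) * inverse a * inverse (1 + w * y) = 1 + w * z0"
    using commutator_form[OF nc] .
  obtain k where k: "k > 0" "(1 + w * z0) ^ k = 1"
    using tors[OF one_plus_nonzero] z0(3) by auto
  have "1 + w * z0 \<noteq> 1" using w(2) z0(2) by simp
  from torsion_prime_power_order[OF k(2,1) this]
  obtain l r where l: "prime l" "((1 + w * z0) ^ r) ^ l = 1" "(1 + w * z0) ^ r \<noteq> 1" .
  obtain z where z: "z \<in> Loc" "(1 + w * z0) ^ r = 1 + w * z"
    using power_one_plus[OF z0(1)] by blast
  note l = l[unfolded z(2)]
  have "\<forall>j. \<exists>u. u \<in> Loc \<and> (1 + w * z) ^ j = 1 + w * u"
    using power_one_plus[OF z(1)] by blast
  then obtain f where f: "f j \<in> Loc" "(1 + w * z) ^ j = 1 + w * f j" for j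
    by (auto dest!: choice)
  have "0 = (\<Sum>j<l. (1 + w * z) ^ j)"
    using geometric_sum_eq_0[OF l(2,3)] by simp
  also have "\<dots> = of_nat l + w * (\<Sum>j<l. f j)"
    unfolding f(2) by (simp add: sum.distrib sum_distrib_left)
  finally have "of_nat l = w * (- (\<Sum>j<l. f j))" by (simp add: eq_neg_iff_add_eq_0)
  moreover have "- (\<Sum>j<l. f j) \<in> Loc" using f(1) by (intro Loc.uminus_mem Loc.sum_mem)
  moreover have "z \<noteq> 0" using l(3) by auto
  ultimately show thesis using that[OF l(1) z(1) _ l(2)] by blast
qed

text \<open>Bezout: otherwise 1 would be a multiple of \<open>w\<close> in
  \<open>Loc\<close>.\<close>

lemma of_nat_coprime:
  assumes "coprime l k" "of_nat l = w * u" "of_nat k = w * u'" "u \<in> Loc" "u' \<in> Loc"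
  shows False
proof -
  obtain x y where "x * int l + y * int k = gcd (int l) (int k)"
    using bezout_int by blast
  then have xy: "x * int l + y * int k = 1" using assms(1) by simp
  have "of_int (x * int l + y * int k) = (1::'a)" unfolding xy by simp
  then have "of_int x * of_nat l + of_int y * of_nat k = (1::'a)" by simp
  then have "of_nat l * of_int x + of_nat k * of_int y = (1::'a)"
    unfolding mult_of_int_commute[of x] mult_of_int_commute[of y] .
  then have "w * (u * of_int x + u' * of_int y) = 1"
    unfolding assms(2,3) by (simp add: distrib_left mult.assoc)
  moreover have "u * of_int x + u' * of_int y \<in> Loc"
    using assms(4,5) by (intro Loc.add_mem Loc.mult_mem Loc.of_int_mem)
  ultimately show False using w_nonunit_Loc by blast
qed

end

section \<open>Finite subrings of division rings are commutative\<close>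

text \<open>Elimination as in Dedekind's independence proof: relation \<open>k + 1\<close> minus
  \<open>\<alpha> i\<close> times relation \<open>k\<close> removes the index \<open>i\<close> and
  turns \<open>b j\<close> into \<open>(\<alpha> j - \<alpha> i) * b j\<close>. The
  \<open>\<alpha> j\<close> commute with each other; the \<open>b j\<close> are arbitrary.\<close>

lemma commuting_vandermonde:
  fixes \<alpha> b :: "'i \<Rightarrow> 'a::division_ring"
  assumes "finite J" "inj_on \<alpha> J"
    and "\<And>i j. i \<in> J \<Longrightarrow> j \<in> J \<Longrightarrow> \<alpha> i * \<alpha> j = \<alpha> j * \<alpha> i"
    and "\<And>k. (\<Sum>j\<in>J. \<alpha> j ^ k * b j) = 0"
    and "j \<in> J"
  shows "b j = 0"
  using assms
proof (induction J arbitrary: b j rule: finite_induct)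
  case (insert i J)
  have b0: "b j = 0" if "j \<in> J" for j
  proof -
    have "(\<alpha> j - \<alpha> i) * b j = 0"
    proof (rule insert.IH[of "\<lambda>j. (\<alpha> j - \<alpha> i) * b j"])
      fix k
      have "(\<Sum>j\<in>J. \<alpha> j ^ k * ((\<alpha> j - \<alpha> i) * b j))
          = (\<Sum>j\<in>insert i J. \<alpha> j ^ k * ((\<alpha> j - \<alpha> i) * b j))"
        using insert(1,2) by simp
      also have "\<dots> = (\<Sum>j\<in>insert i J. \<alpha> j ^ Suc k * b j - \<alpha> i * (\<alpha> j ^ k * b j))"
      proof (rule sum.cong[OF refl])
        fix j assume "j \<in> insert i J"
        then have "\<alpha> j * \<alpha> i = \<alpha> i * \<alpha> j" using insert.prems(2) by blast
        then have "\<alpha> j ^ k * \<alpha> i = \<alpha> i * \<alpha> j ^ k" by (rule power_commuting_commutes)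
        then have "\<alpha> j ^ k * (\<alpha> i * b j) = \<alpha> i * (\<alpha> j ^ k * b j)"
          by (simp only: mult.assoc[symmetric])
        then show "\<alpha> j ^ k * ((\<alpha> j - \<alpha> i) * b j) = \<alpha> j ^ Suc k * b j - \<alpha> i * (\<alpha> j ^ k * b j)"
          by (simp add: left_diff_distrib right_diff_distrib power_Suc2 mult.assoc del: power_Suc)
      qed
      also have "\<dots> = 0"
        unfolding sum_subtractf sum_distrib_left[symmetric] insert.prems(3) by simp
      finally show "(\<Sum>j\<in>J. \<alpha> j ^ k * ((\<alpha> j - \<alpha> i) * b j)) = 0" .
    qed (use insert.prems that in auto)
    moreover have "\<alpha> j \<noteq> \<alpha> i" using insert(2) insert.prems(1) that by (auto simp: inj_on_def)
    ultimately show ?thesis by simp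
  qed
  moreover have "b i = 0" using insert.prems(3)[of 0] insert(1,2) b0 by simp
  ultimately show ?case using insert.prems(4) by auto
qed simp

lemma finite_powers_torsion:
  fixes x :: "'a::division_ring"
  assumes "finite (range (\<lambda>n::nat. x ^ n))" "x \<noteq> 0"
  obtains n where "n > 0" "x ^ n = 1"
proof -
  have "\<not> inj (\<lambda>n::nat. x ^ n)" using assms(1) finite_imageD infinite_UNIV_nat by blast
  then obtain i j where ij: "i < j" "x ^ i = x ^ j"
    unfolding inj_def by (metis linorder_neqE_nat)
  have "x ^ i * x ^ (j - i) = x ^ j" using ij(1) by (simp add: power_add[symmetric])
  then have "x ^ i * x ^ (j - i) = x ^ i * 1" using ij(2) by simp
  then have "x ^ (j - i) = 1" using assms(2) by simp
  then show thesis using that[of "j - i"] ij by simp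
qed

lemma (in unital_subring) finite_powers:
  assumes "finite R" "x \<in> R"
  shows "finite (range (\<lambda>n::nat. x ^ n))"
  by (rule finite_subset[OF _ assms(1)]) (auto intro: power_mem assms(2))

text \<open>A counterexample to Wedderburn's theorem in normal form, refuted through cyclic
  algebras: conjugation by \<open>y\<close> acts on a finite field \<open>L\<close> as an
  automorphism of order \<open>m\<close> with fixed field \<open>K\<close>. The norm maps onto the
  nonzero elements of \<open>K\<close>, so some \<open>u * y\<close> has \<open>m\<close>-th power
  1. The geometric sum of its powers then vanishes, although these powers are independent.\<close>

locale finite_normalized =
  fixes B :: "'a::division_ring set" and a y :: 'a and e :: nat
  assumes B: "unital_subring B" "finite B"
    and mem: "a \<in> B" "y \<in> B"
    and rel: "y * a = a ^ e * y"
    and nc: "y * a \<noteq> a * y"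
begin

sublocale unital_subring B by (rule B)

lemma inverse_mem: "x \<in> B \<Longrightarrow> inverse x \<in> B"
proof (cases "x = 0")
  case False
  assume x: "x \<in> B"
  obtain n where "n > 0" "x ^ n = 1"
    using finite_powers_torsion[OF finite_powers[OF B(2) x] False] .
  then show ?thesis using torsion_inverse power_mem[OF x] by metis
qed (simp add: zero_mem)

lemma nonzero: "y \<noteq> 0" "a \<noteq> 0"
  using nc by auto

definition m :: nat
  where "m = (LEAST j. j > 0 \<and> y ^ j * a = a * y ^ j)"

lemma m: "m > 0" "y ^ m * a = a * y ^ m"
  and m_min: "0 < j \<Longrightarrow> j < m \<Longrightarrow> y ^ j * a \<noteq> a * y ^ j"
proof -
  obtain n where "n > 0" "a ^ n = 1"
    using finite_powers_torsion[OF finite_powers[OF B(2) mem(1)] nonzero(2)] .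
  then obtain k where k: "k > 0" "y ^ k * a = a * y ^ k"
    using normalizing_power_commutes[OF _ _ rel nonzero(1)] by blast
  show "m > 0" "y ^ m * a = a * y ^ m"
    using LeastI[of "\<lambda>j. j > 0 \<and> y ^ j * a = a * y ^ j" k] k unfolding m_def by auto
  show "y ^ j * a \<noteq> a * y ^ j" if "0 < j" "j < m"
    using not_less_Least[of j "\<lambda>j. j > 0 \<and> y ^ j * a = a * y ^ j"] that unfolding m_def by auto
qed

text \<open>
  \<open>Z\<close> is the centralizer of \<open>{a, y ^ m}\<close> in \<open>B\<close>, and \<open>L\<close> the centralizer of \<open>Z\<close>: a
  commutative subring containing \<open>a\<close> and \<open>y ^ m\<close> and normalized by \<open>y\<close>.
\<close>

definition Z :: "'a set"
  where "Z = {z \<in> B. z * a = a * z \<and> z * y ^ m = y ^ m * z}"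

definition L :: "'a set"
  where "L = {x \<in> B. \<forall>z\<in>Z. x * z = z * x}"

definition K :: "'a set"
  where "K = {x \<in> L. x * y = y * x}"

lemma ym_mem_Z: "y ^ m \<in> Z"
  unfolding Z_def using m power_mem[OF mem(2)] by simp

lemma a_mem_Z: "a \<in> Z"
  unfolding Z_def using m mem(1) by simp

lemma L_subset_Z: "L \<subseteq> Z"
  using a_mem_Z ym_mem_Z by (auto simp: L_def Z_def)

lemma L_commute: "x \<in> L \<Longrightarrow> x' \<in> L \<Longrightarrow> x * x' = x' * x"
  using L_subset_Z by (auto simp: L_def)

lemma mem_L: "a \<in> L" "y ^ m \<in> L"
  using a_mem_Z ym_mem_Z by (auto simp: L_def Z_def)

sublocale L: unital_subring L
proof
  show "1 \<in> L" using one_mem by (simp add: L_def)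
  fix x x' assume "x \<in> L" "x' \<in> L"
  then have x: "x \<in> B" "x' \<in> B" "\<And>z. z \<in> Z \<Longrightarrow> x * z = z * x" "\<And>z. z \<in> Z \<Longrightarrow> x' * z = z * x'"
    by (auto simp: L_def)
  show "x - x' \<in> L" using x diff_mem by (auto simp: L_def algebra_simps)
  have "x * x' * z = z * (x * x')" if "z \<in> Z" for z
    using x(3,4)[OF that] by (metis mult.assoc)
  then show "x * x' \<in> L" using x(1,2) mult_mem by (auto simp: L_def)
qed

lemma L_inverse: "x \<in> L \<Longrightarrow> inverse x \<in> L"
  using inverse_mem commute_inverse[of _ x] by (auto simp: L_def)

text \<open>It suffices that \<open>inverse y * z * y\<close> stays in \<open>Z\<close> for
  \<open>z\<close> in \<open>Z\<close>. It commutes with \<open>a\<close> because \<open>z\<close>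
  commutes with \<open>a ^ e\<close>, the conjugate of \<open>a\<close> by \<open>y\<close>, and
  with \<open>y ^ m\<close> because \<open>y\<close> does.\<close>

lemma L_conj:
  assumes x: "x \<in> L"
  shows "y * x * inverse y \<in> L"
proof -
  have xB: "x \<in> B" using x by (simp add: L_def)
  have "y * x * inverse y * z = z * (y * x * inverse y)" if z: "z \<in> Z" for z
  proof -
    have zB: "z \<in> B" "z * a = a * z" "z * y ^ m = y ^ m * z" using z by (auto simp: Z_def)
    define z' where "z' = inverse y * z * y"
    have yz': "y * z' = z * y"
      using nonzero by (simp add: z'_def mult.assoc[symmetric])
    have "y * (z' * a) = z * (y * a)" using yz' by (simp add: mult.assoc[symmetric])
    also have "\<dots> = (z * a ^ e) * y" unfolding rel by (simp add: mult.assoc)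
    also have "z * a ^ e = a ^ e * z"
      using power_commuting_commutes[OF zB(2)[symmetric], of e] by simp
    also have "a ^ e * z * y = a ^ e * y * z'" using yz' by (simp add: mult.assoc)
    also have "\<dots> = y * (a * z')" unfolding rel[symmetric] by (simp add: mult.assoc)
    finally have 1: "z' * a = a * z'" using nonzero by simp
    have "y * (z' * y ^ m) = z * (y * y ^ m)" using yz' by (simp add: mult.assoc[symmetric])
    also have "\<dots> = (z * y ^ m) * y" by (simp add: power_commutes mult.assoc)
    also have "\<dots> = y ^ m * (y * z')" unfolding zB(3) yz' by (simp add: mult.assoc)
    also have "\<dots> = y * (y ^ m * z')" by (simp add: power_commutes mult.assoc[symmetric])
    finally have 2: "z' * y ^ m = y ^ m * z'" using nonzero by simp
    have "z' \<in> B" unfolding z'_def using zB(1) mem(2) inverse_mem by (intro mult_mem)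
    then have "z' \<in> Z" using 1 2 by (simp add: Z_def)
    then have xz': "x * z' = z' * x" using x by (simp add: L_def)
    have "inverse y * z = z' * inverse y"
      using nonzero by (simp add: z'_def mult.assoc)
    then have "y * x * inverse y * z = y * (x * z') * inverse y" by (simp add: mult.assoc)
    also have "\<dots> = (y * z') * x * inverse y" unfolding xz' by (simp add: mult.assoc)
    also have "\<dots> = z * (y * x * inverse y)" unfolding yz' by (simp add: mult.assoc)
    finally show ?thesis .
  qed
  then show ?thesis using xB mem(2) inverse_mem mult_mem by (auto simp: L_def)
qed

lemma finite_L: "finite L"
  using B(2) by (rule finite_subset[rotated]) (auto simp: L_def)

text \<open>As \<open>L\<close> is commutative, \<open>u * y\<close> and \<open>y\<close> induce the
  same conjugation on \<open>L\<close>.\<close>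

lemma conj_uy:
  assumes u: "u \<in> L" "u \<noteq> 0" and x: "x \<in> L"
  shows "u * y * x = (y * x * inverse y) * (u * y)"
proof -
  have "u * y * x = u * (y * x * inverse y) * y" using nonzero by (simp add: mult.assoc)
  also have "u * (y * x * inverse y) = (y * x * inverse y) * u"
    using L_commute[OF u(1) L_conj[OF x]] .
  finally show ?thesis by (simp add: mult.assoc)
qed

lemma L_conj_power: "x \<in> L \<Longrightarrow> y ^ j * x * inverse (y ^ j) \<in> L"
proof (induction j)
  case (Suc j)
  have "y ^ Suc j * x * inverse (y ^ Suc j) = y * (y ^ j * x * inverse (y ^ j)) * inverse y"
    using nonzero by (simp add: nonzero_inverse_mult_distrib power_commutes mult.assoc)
  then show ?case using L_conj Suc by simp
qed simp

lemma power_uy: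
  assumes u: "u \<in> L" "u \<noteq> 0" and x: "x \<in> L"
  shows "(u * y) ^ j * x = (y ^ j * x * inverse (y ^ j)) * (u * y) ^ j"
proof (induction j)
  case (Suc j)
  let ?x = "y ^ j * x * inverse (y ^ j)"
  have "(u * y) ^ Suc j * x = u * y * ?x * (u * y) ^ j"
    using Suc by (simp add: mult.assoc)
  also have "u * y * ?x = (y * ?x * inverse y) * (u * y)"
    using conj_uy[OF u L_conj_power[OF x]] .
  also have "y * ?x * inverse y = y ^ Suc j * x * inverse (y ^ Suc j)"
    using nonzero by (simp add: nonzero_inverse_mult_distrib mult.assoc power_commutes)
  finally show ?case by (simp add: mult.assoc)
qed simp

text \<open>Moving \<open>a ^ k\<close> to the left of \<open>(u * y) ^ j\<close> turns it into the
  \<open>k\<close>-th power of the conjugate \<open>\<alpha> j\<close> of \<open>a\<close>. These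
  conjugates commute, lying in \<open>L\<close>, and are distinct for \<open>j < m\<close> by
  minimality of \<open>m\<close>; so the hypothesis is a Vandermonde system.\<close>

lemma independence:
  assumes u: "u \<in> L" "u \<noteq> 0"
    and zero: "\<And>k. (\<Sum>j<m. (u * y) ^ j * a ^ k * d j) = 0"
  shows "d 0 = 0"
proof -
  define \<alpha> where "\<alpha> j = y ^ j * a * inverse (y ^ j)" for j
  have \<alpha>: "\<alpha> j \<in> L" for j unfolding \<alpha>_def using L_conj_power mem_L by blast
  have \<alpha>k: "y ^ j * a ^ k * inverse (y ^ j) = \<alpha> j ^ k" for j k
  proof (induction k)
    case (Suc k)
    have "\<alpha> j ^ Suc k = \<alpha> j * (y ^ j * a ^ k * inverse (y ^ j))" using Suc by simp
    also have "\<dots> = y ^ j * a * (inverse (y ^ j) * y ^ j) * a ^ k * inverse (y ^ j)"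
      by (simp add: \<alpha>_def mult.assoc)
    finally show ?case using nonzero by (simp add: mult.assoc)
  qed (use nonzero in simp)
  have neq: "\<alpha> i \<noteq> \<alpha> j" if "i < j" "j < m" for i j
  proof
    assume eq: "\<alpha> i = \<alpha> j"
    have yj: "y ^ j = y ^ i * y ^ (j - i)" using that by (simp add: power_add[symmetric])
    have "y ^ i * (y ^ (j - i) * a) = \<alpha> j * y ^ j"
      unfolding \<alpha>_def using nonzero yj by (simp add: mult.assoc)
    also have "\<dots> = \<alpha> i * y ^ i * y ^ (j - i)" using eq yj by (simp add: mult.assoc)
    also have "\<alpha> i * y ^ i = y ^ i * a" unfolding \<alpha>_def using nonzero by (simp add: mult.assoc)
    finally have "y ^ (j - i) * a = a * y ^ (j - i)" using nonzero by (simp add: mult.assoc)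
    then show False using m_min[of "j - i"] that by simp
  qed
  have "(u * y) ^ 0 * d 0 = 0"
  proof (rule commuting_vandermonde[of "{..<m}" \<alpha> "\<lambda>j. (u * y) ^ j * d j"])
    show "inj_on \<alpha> {..<m}"
      by (rule inj_onI) (metis neq lessThan_iff linorder_neqE_nat)
    show "\<alpha> i * \<alpha> j = \<alpha> j * \<alpha> i" for i j using L_commute \<alpha> by blast
    fix k
    have "(u * y) ^ j * a ^ k = \<alpha> j ^ k * (u * y) ^ j" for j
      using power_uy[OF u L.power_mem[OF mem_L(1)], of j k] unfolding \<alpha>k .
    then show "(\<Sum>j<m. \<alpha> j ^ k * ((u * y) ^ j * d j)) = 0"
      using zero[of k] by (simp add: mult.assoc[symmetric])
  qed (use m in auto)
  then show ?thesis by simp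
qed

text \<open>The map sending \<open>x\<close> to \<open>u * y * x * inverse (u' * y)\<close>
  preserves \<open>L\<close>, and its \<open>m\<close>-th iterate fixes each \<open>a ^ k\<close>
  because the two \<open>m\<close>-th powers agree. Hence the orbit sum \<open>V k\<close> is a
  fixed point, and a nonzero fixed point \<open>v\<close> is what the conclusion asks for.\<close>

lemma hilbert90:
  assumes u: "u \<in> L" "u \<noteq> 0" and u': "u' \<in> L" "u' \<noteq> 0"
    and eq: "(u * y) ^ m = (u' * y) ^ m"
  obtains v where "v \<in> L" "v \<noteq> 0" "u = u' * (v * y * inverse v * inverse y)"
proof -
  let ?z = "u * y" and ?z' = "u' * y"
  have nz: "?z' \<noteq> 0" using u' nonzero by simp
  define f where "f k j = ?z ^ j * a ^ k * inverse (?z' ^ j)" for k j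
  have f_Suc: "f k (Suc j) = ?z * f k j * inverse ?z'" for k j
    using nz by (simp add: f_def nonzero_inverse_mult_distrib mult.assoc)
  have fL: "f k j \<in> L" for k j
  proof (induction j)
    case 0
    then show ?case using L.power_mem mem_L by (simp add: f_def)
  next
    case (Suc j)
    have "f k (Suc j) = u * (y * f k j * inverse y) * inverse u'"
      unfolding f_Suc using u' nonzero by (simp add: nonzero_inverse_mult_distrib mult.assoc)
    then show ?case using L.mult_mem u u' L_conj[OF Suc] L_inverse by simp
  qed
  have fm: "f k m = f k 0" for k
  proof -
    have "y ^ m * a ^ k * inverse (y ^ m) = a ^ k"
    proof -
      have "a ^ k * y ^ m = y ^ m * a ^ k"
        using power_commuting_commutes[OF m(2)[symmetric]] by simp
      then show ?thesis using nonzero by (simp add: mult.assoc flip: \<open>a ^ k * y ^ m = y ^ m * a ^ k\<close>)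
    qed
    then have "?z ^ m * a ^ k = a ^ k * ?z ^ m"
      using power_uy[OF u L.power_mem[OF mem_L(1)], of m k] by simp
    then have "f k m = a ^ k * ?z' ^ m * inverse (?z' ^ m)" unfolding f_def eq by simp
    then show ?thesis using nz by (simp add: f_def mult.assoc)
  qed
  define V where "V k = (\<Sum>j<m. f k j)" for k
  have VL: "V k \<in> L" for k unfolding V_def using fL by (rule L.sum_mem)
  have rel: "?z * V k = V k * ?z'" for k
  proof -
    have "?z * V k * inverse ?z' = (\<Sum>j<m. f k (Suc j))"
      unfolding V_def f_Suc by (simp add: sum_distrib_left sum_distrib_right)
    also have "\<dots> = (\<Sum>j<Suc m. f k j) - f k 0" by (subst sum.lessThan_Suc_shift) simp
    also have "\<dots> = V k" using fm by (simp add: V_def)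
    finally have *: "?z * V k * inverse ?z' = V k" .
    have "?z * V k = (?z * V k * inverse ?z') * ?z'" using nz by (simp add: mult.assoc)
    then show ?thesis unfolding * .
  qed
  have "\<exists>k. V k \<noteq> 0"
  proof (rule ccontr)
    assume "\<nexists>k. V k \<noteq> 0"
    \<comment> \<open>If all \<open>V k\<close> vanish, \<open>independence\<close> applies with
      coefficients \<open>inverse (?z' ^ j)\<close>, whose value at \<open>j = 0\<close> is
      1.\<close>
    then have "inverse (?z' ^ 0) = 0"
      by (intro independence[OF u, of "\<lambda>j. inverse (?z' ^ j)"]) (auto simp: V_def f_def)
    then show False by simp
  qed
  then obtain k where k: "V k \<noteq> 0" by blast
  let ?v = "V k"
  have "u * (y * ?v * inverse y) = ?v * u'"
    using arg_cong[OF rel[of k], of "\<lambda>x. x * inverse y"] nonzero by (simp add: mult.assoc)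
  then have "u * (y * ?v * inverse y) = u' * ?v" using L_commute[OF VL u'(1)] by simp
  then have "u = u' * ?v * inverse (y * ?v * inverse y)"
    using k nonzero by (intro eq_mult_inverse) auto
  also have "\<dots> = u' * (?v * y * inverse ?v * inverse y)"
    using k nonzero by (simp add: nonzero_inverse_mult_distrib mult.assoc)
  finally show thesis using that VL k by blast
qed

text \<open>
  Counting fibres: \<open>v \<mapsto> v y v\<^sup>-\<^sup>1 y\<^sup>-\<^sup>1\<close> is \<open>|K*|\<close>-to-one on \<open>L*\<close>, and by Hilbert 90
  the fibres of \<open>u \<mapsto> (u y) ^ m\<close> are no larger than its image, so the latter is onto \<open>K*\<close>.
\<close>

lemma obtain_power_eq_one:
  obtains u where "u \<in> L" "u \<noteq> 0" "(u * y) ^ m = 1"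
proof -
  let ?L = "L - {0}" and ?K = "K - {0}"
  define h where "h v = v * y * inverse v * inverse y" for v
  define \<nu> where "\<nu> u = (u * y) ^ m" for u
  have fin: "finite ?L" "finite ?K" using finite_L by (auto simp: K_def)
  have fibre_h: "card {v \<in> ?L. h v = h v0} = card ?K" if v0: "v0 \<in> ?L" for v0
  proof -
    have "bij_betw (\<lambda>k. v0 * k) ?K {v \<in> ?L. h v = h v0}"
    proof (rule bij_betwI[where g = "\<lambda>v. inverse v0 * v"])
      show "(\<lambda>k. v0 * k) \<in> ?K \<rightarrow> {v \<in> ?L. h v = h v0}"
      proof
        fix k assume k: "k \<in> ?K"
        then have "k * y = y * k" "k \<in> L" "k \<noteq> 0" by (auto simp: K_def)
        then have "k * y * inverse k = y" by (simp add: mult.assoc)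
        then have "h (v0 * k) = h v0"
          using v0 \<open>k \<noteq> 0\<close> unfolding h_def
          by (simp add: nonzero_inverse_mult_distrib) (simp add: mult.assoc[symmetric], simp add: mult.assoc)
        then show "v0 * k \<in> {v \<in> ?L. h v = h v0}"
          using v0 \<open>k \<in> L\<close> \<open>k \<noteq> 0\<close> L.mult_mem by auto
      qed
      show "(\<lambda>v. inverse v0 * v) \<in> {v \<in> ?L. h v = h v0} \<rightarrow> ?K"
      proof
        fix v assume "v \<in> {v \<in> ?L. h v = h v0}"
        then have v: "v \<in> L" "v \<noteq> 0" "h v = h v0" by auto
        have "v * y * inverse v = v0 * y * inverse v0"
          using v(3) nonzero unfolding h_def by simp
        then have "inverse v0 * (v * y * inverse v) * v = inverse v0 * (v0 * y * inverse v0) * v"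
          by simp
        then have "inverse v0 * v * y = y * (inverse v0 * v)"
          using v(2) v0 by (simp add: mult.assoc) (simp add: mult.assoc[symmetric])
        then show "inverse v0 * v \<in> ?K"
          using v v0 L_inverse L.mult_mem by (auto simp: K_def)
      qed
    qed (use v0 in \<open>auto simp: mult.assoc[symmetric]\<close>)
    then show ?thesis using bij_betw_same_card by fastforce
  qed
  have "card ?L = (\<Sum>b\<in>h ` ?L. card {v \<in> ?L. h v = b})"
    using sum.image_gen[OF fin(1), of "\<lambda>_. 1::nat" h] by simp
  also have "\<dots> = (\<Sum>b\<in>h ` ?L. card ?K)"
    by (rule sum.cong) (use fibre_h in auto)
  finally have card1: "card ?L = card (h ` ?L) * card ?K" by simp
  have fibre_\<nu>: "card {u \<in> ?L. \<nu> u = \<nu> u0} \<le> card (h ` ?L)" if u0: "u0 \<in> ?L" for u0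
  proof -
    have "{u \<in> ?L. \<nu> u = \<nu> u0} \<subseteq> (\<lambda>x. u0 * x) ` (h ` ?L)"
    proof
      fix u assume "u \<in> {u \<in> ?L. \<nu> u = \<nu> u0}"
      then obtain v where "v \<in> L" "v \<noteq> 0" "u = u0 * h v"
        using hilbert90[of u u0] u0 unfolding \<nu>_def h_def by auto
      then show "u \<in> (\<lambda>x. u0 * x) ` (h ` ?L)" by blast
    qed
    then have "card {u \<in> ?L. \<nu> u = \<nu> u0} \<le> card ((\<lambda>x. u0 * x) ` (h ` ?L))"
      using fin by (intro card_mono) auto
    also have "\<dots> \<le> card (h ` ?L)" using fin by (intro card_image_le) auto
    finally show ?thesis .
  qed
  have "card ?L = (\<Sum>b\<in>\<nu> ` ?L. card {u \<in> ?L. \<nu> u = b})"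
    using sum.image_gen[OF fin(1), of "\<lambda>_. 1::nat" \<nu>] by simp
  also have "\<dots> \<le> (\<Sum>b\<in>\<nu> ` ?L. card (h ` ?L))"
    by (rule sum_mono) (use fibre_\<nu> in auto)
  finally have "card (h ` ?L) * card ?K \<le> card (h ` ?L) * card (\<nu> ` ?L)"
    unfolding card1 by (simp add: mult.commute)
  moreover have "card (h ` ?L) > 0"
    using fin(1) mem_L(1) nonzero by (auto simp: card_gt_0_iff)
  ultimately have le: "card ?K \<le> card (\<nu> ` ?L)" by simp
  \<comment> \<open>The element \<open>t\<close> is a norm in \<open>L\<close> times
    \<open>y ^ m\<close>, so it lies in \<open>L\<close> and commutes with \<open>u\<close>; as a
    power of \<open>u * y\<close> it also commutes with \<open>u * y\<close>, hence with
    \<open>y\<close>.\<close>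
  have "\<nu> ` ?L \<subseteq> ?K"
  proof
    fix t assume "t \<in> \<nu> ` ?L"
    then obtain u where u: "u \<in> L" "u \<noteq> 0" "t = (u * y) ^ m" by (auto simp: \<nu>_def)
    have T: "(u * y) ^ j * inverse (y ^ j) \<in> L" for j
    proof (induction j)
      case 0
      then show ?case using L.one_mem by simp
    next
      case (Suc j)
      have "(u * y) ^ Suc j * inverse (y ^ Suc j) = u * (y * ((u * y) ^ j * inverse (y ^ j)) * inverse y)"
        using nonzero by (simp add: nonzero_inverse_mult_distrib mult.assoc)
      then show ?case using u L_conj[OF Suc] L.mult_mem by simp
    qed
    have "t = ((u * y) ^ m * inverse (y ^ m)) * y ^ m" using u(3) nonzero by (simp add: mult.assoc)
    then have tL: "t \<in> L" using L.mult_mem[OF T mem_L(2)] by simp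
    have "u * (y * t) = (u * y) ^ m * (u * y)" unfolding u(3) power_commutes by (simp add: mult.assoc)
    also have "\<dots> = (t * u) * y" unfolding u(3) by (simp add: mult.assoc)
    also have "t * u = u * t" using L_commute[OF tL u(1)] .
    finally have "y * t = t * y" using u(2) by (simp add: mult.assoc)
    then show "t \<in> ?K" using tL u nonzero by (auto simp: K_def)
  qed
  then have "\<nu> ` ?L = ?K" using le fin by (metis card_subset_eq card_mono le_antisym)
  moreover have "1 \<in> ?K" using L.one_mem by (simp add: K_def)
  ultimately obtain u where "u \<in> ?L" "\<nu> u = 1" by (metis imageE)
  then show thesis using that by (auto simp: \<nu>_def)
qed

lemma contradiction: False
proof -
  obtain u where u: "u \<in> L" "u \<noteq> 0" "(u * y) ^ m = 1" by (rule obtain_power_eq_one)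
  \<comment> \<open>Conjugation by \<open>u * y\<close> agrees with that by \<open>y\<close> on
    \<open>L\<close>, and the latter moves \<open>a\<close>.\<close>
  have "u * y \<noteq> 1"
  proof
    assume "u * y = 1"
    then have "y * a * inverse y = a" using conj_uy[OF u(1,2) mem_L(1)] by simp
    then have "y * a = a * y" using nonzero by (metis mult.assoc left_inverse mult.right_neutral)
    then show False using nc by blast
  qed
  then have "(\<Sum>j<m. (u * y) ^ j) = 0" using geometric_sum_eq_0[OF u(3)] by blast
  then have "(\<Sum>j<m. (u * y) ^ j * a ^ k * 1) = 0" for k
    by (simp add: sum_distrib_right[symmetric])
  then have "(1::'a) = 0" by (rule independence[OF u(1,2)])
  then show False by simp
qed

end

text \<open>A noncommuting pair \<open>x\<close>, \<open>a\<close> yields a noncommuting pair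
  \<open>y\<close>, \<open>a\<close> with \<open>y\<close> normalizing the powers of
  \<open>a\<close>; the explicit sum for \<open>y\<close> keeps it inside \<open>B\<close>.\<close>

theorem finite_subring_commutative:
  fixes B :: "'a::division_ring set"
  assumes B: "unital_subring B" "finite B" and xa: "x \<in> B" "a \<in> B"
  shows "x * a = a * x"
proof (rule ccontr)
  assume nc: "x * a \<noteq> a * x"
  interpret unital_subring B by fact
  have "a \<noteq> 0" using nc by auto
  then obtain k where "k > 0" "a ^ k = 1"
    using finite_powers_torsion[OF finite_powers[OF B(2) xa(2)]] by blast
  then obtain n where n: "n > 0" "a ^ n = 1" "\<And>j. 0 < j \<Longrightarrow> j < n \<Longrightarrow> a ^ j \<noteq> 1"
    "of_nat n \<noteq> (0::'a)" using torsion_order by metis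
  obtain y e j where y: "y = (\<Sum>k<n. a ^ (j * k) * x * a ^ k)" "y * a = a ^ e * y" "y * a \<noteq> a * y"
    using normalize_torsion[OF n nc] .
  have "y \<in> B" unfolding y(1) using xa by (intro sum_mem mult_mem power_mem)
  then interpret finite_normalized B a y e
    using B xa y by unfold_locales (auto intro: one_mem diff_mem mult_mem)
  show False by (rule contradiction)
qed

section \<open>Torsion elements with torsion commutators\<close>

text \<open>The subring generated by \<open>s\<close>, built by Horner steps so that its closure
  properties follow by rule induction.\<close>

inductive_set int_poly_values :: "'a::ring_1 \<Rightarrow> 'a set" for s :: 'a where
  zero: "0 \<in> int_poly_values s"
| horner: "x \<in> int_poly_values s \<Longrightarrow> of_int c + s * x \<in> int_poly_values s"

lemma int_poly_values_commute:
  assumes "s * t = t * s" "x \<in> int_poly_values s"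
  shows "x * t = t * x"
  using assms(2)
proof induction
  case (horner x c)
  have "(of_int c + s * x) * t = of_int c * t + s * (t * x)"
    using horner by (simp add: distrib_right mult.assoc)
  also have "\<dots> = t * of_int c + (s * t) * x"
    using mult_of_int_commute[of c t] by (simp add: mult.assoc)
  finally show ?case using assms(1) by (simp add: distrib_left mult.assoc)
qed simp

lemma int_poly_values_shift: "x \<in> int_poly_values s \<Longrightarrow> s * x \<in> int_poly_values s"
  using int_poly_values.horner[of x s 0] by simp

lemma int_poly_values_of_int: "of_int c \<in> int_poly_values s"
  using int_poly_values.horner[OF int_poly_values.zero, of c s] by simp

lemma int_poly_values_add:
  assumes "x \<in> int_poly_values s" "z \<in> int_poly_values s"
  shows "x + z \<in> int_poly_values s"
  using assms
proof (induction arbitrary: z)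
  case (horner x c)
  note IH = horner.IH
  from horner.prems show ?case
  proof cases
    case zero
    then show ?thesis using int_poly_values.horner[OF horner.hyps] by simp
  next
    case (horner z' d)
    have eq: "of_int c + s * x + z = of_int (c + d) + s * (x + z')"
      by (simp add: horner(1) algebra_simps)
    show ?thesis unfolding eq by (rule int_poly_values.horner[OF IH[OF horner(2)]])
  qed
qed simp

lemma int_poly_values_scale: "x \<in> int_poly_values s \<Longrightarrow> of_int d * x \<in> int_poly_values s"
proof (induction rule: int_poly_values.induct)
  case (horner x c)
  have "of_int d * (of_int c + s * x) = of_int d * of_int c + (of_int d * s) * x"
    by (simp add: distrib_left mult.assoc)
  also have "\<dots> = of_int (d * c) + s * (of_int d * x)"
    unfolding mult_of_int_commute[of d s] by (simp add: mult.assoc)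
  finally have eq: "of_int d * (of_int c + s * x) = of_int (d * c) + s * (of_int d * x)" .
  show ?case unfolding eq by (rule int_poly_values.horner[OF horner.IH])
qed (simp add: int_poly_values.zero)

lemma int_poly_values_mult:
  assumes "x \<in> int_poly_values s" "z \<in> int_poly_values s"
  shows "x * z \<in> int_poly_values s"
  using assms
proof (induction)
  case (horner x c)
  then show ?case
    using int_poly_values_add[OF int_poly_values_scale[OF assms(2), of c] int_poly_values_shift, of "x * z"]
    by (simp add: distrib_right mult.assoc)
qed (simp add: int_poly_values.zero)

lemma unital_subring_int_poly_values: "unital_subring (int_poly_values s)"
proof
  show "1 \<in> int_poly_values s" using int_poly_values_of_int[of 1] by simp
  show "x - y \<in> int_poly_values s" if "x \<in> int_poly_values s" "y \<in> int_poly_values s" for x y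
    using int_poly_values_add[OF that(1) int_poly_values_scale[OF that(2), of "-1"]] by simp
qed (rule int_poly_values_mult)

lemma int_poly_values_base: "s \<in> int_poly_values s"
  using int_poly_values_shift[OF int_poly_values_of_int[of 1 s]] by simp

lemma int_poly_values_commutative:
  assumes "x \<in> int_poly_values s" "z \<in> int_poly_values s"
  shows "x * z = z * x"
  using int_poly_values_commute[OF int_poly_values_commute[OF refl assms(2), symmetric] assms(1)] .

lemma int_poly_values_expand:
  assumes "x \<in> int_poly_values s"
  obtains k :: nat and c :: "nat \<Rightarrow> int" where "x = (\<Sum>i<k. of_int (c i) * s ^ i)"
proof -
  have "\<exists>(k::nat) c :: nat \<Rightarrow> int. x = (\<Sum>i<k. of_int (c i) * s ^ i)"
    using assms
  proof induction
    case zero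
    then show ?case by (intro exI[of _ 0]) simp
  next
    case (horner x c)
    then obtain k :: nat and d :: "nat \<Rightarrow> int" where x: "x = (\<Sum>i<k. of_int (d i) * s ^ i)" by blast
    have "s * x = (\<Sum>i<k. of_int (d i) * s ^ Suc i)"
      unfolding x sum_distrib_left
    proof (rule sum.cong[OF refl])
      fix i
      show "s * (of_int (d i) * s ^ i) = of_int (d i) * s ^ Suc i"
        unfolding mult.assoc[symmetric] mult_of_int_commute[of "d i" s, symmetric]
        by (simp add: mult.assoc)
    qed
    then have "of_int c + s * x = (\<Sum>i<Suc k. of_int (case i of 0 \<Rightarrow> c | Suc j \<Rightarrow> d j) * s ^ i)"
      by (subst sum.lessThan_Suc_shift) simp
    then show ?case by blast
  qed
  then show thesis using that by blast
qed

text \<open>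
  If \<open>w f(s) = 1\<close> and \<open>w g(1/s) = 1\<close> with \<open>deg f < k\<close> and \<open>deg g < l\<close>, then the
  \<open>\<int>\<close>-span \<open>V\<close> of \<open>1, s, \<dots>, s ^ (k + l)\<close> satisfies \<open>V = w V\<close>, against Nakayama.
\<close>

lemma not_both_invert_int:
  fixes s :: "'a::division_ring" and w :: int
  assumes s: "s \<noteq> 0"
    and w: "\<And>c::int. of_int w * of_int c \<noteq> (1::'a)"
    and x: "x \<in> int_poly_values s" "of_int w * x = 1"
    and z: "z \<in> int_poly_values (inverse s)" "of_int w * z = 1"
  shows False
proof -
  obtain k :: nat and c :: "nat \<Rightarrow> int" where c: "x = (\<Sum>i<k. of_int (c i) * s ^ i)"
    by (rule int_poly_values_expand[OF x(1)])
  obtain l :: nat and d :: "nat \<Rightarrow> int" where d: "z = (\<Sum>i<l. of_int (d i) * inverse s ^ i)"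
    by (rule int_poly_values_expand[OF z(1)])
  let ?I = "{..k + l}" and ?S = "range (of_int :: int \<Rightarrow> 'a)"
  interpret unital_subring ?S by (rule unital_subring_range_of_int)
  show False
  proof (rule nakayama_one_notin[of ?S "of_int w" ?I 0 "\<lambda>i. s ^ i"])
    show "u * v = v * u" if "u \<in> ?S" "v \<in> ?S" for u v
      using that mult_of_int_commute by blast
    show "of_int w * u \<noteq> 1" if "u \<in> ?S" for u using that w by blast
  next
    fix i assume i: "i \<in> ?I"
    have base: "of_int b * s ^ j \<in> gspan ?S (\<lambda>i. s ^ i) ?I" if "j \<le> k + l" for b j
      using that gspan_base[of ?I j "\<lambda>i. s ^ i"] by (intro gspan_scale) auto
    show "\<exists>u\<in>gspan ?S (\<lambda>i. s ^ i) ?I. s ^ i = of_int w * u"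
    \<comment> \<open>Multiplying by \<open>x\<close> raises exponents by less than
      \<open>k\<close>, multiplying by \<open>z\<close> lowers them by less than \<open>l\<close>.
      Low exponents are therefore divided by \<open>w\<close> using \<open>x\<close>, high ones
      using \<open>z\<close>, and both results stay between 0 and \<open>k + l\<close>.\<close>
    proof (cases "i \<le> l")
      case True
      have "x * s ^ i = (\<Sum>j<k. of_int (c j) * s ^ (j + i))"
        unfolding c sum_distrib_right by (simp add: power_add mult.assoc)
      also have "\<dots> \<in> gspan ?S (\<lambda>i. s ^ i) ?I"
        using True by (intro gspan_sum base) auto
      finally show ?thesis
        using x(2) by (intro bexI[of _ "x * s ^ i"]) (simp_all add: mult.assoc[symmetric])
    next
      case False
      have "inverse s ^ j * s ^ i = s ^ (i - j)" if "j < l" for j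
      proof -
        have "s ^ i = s ^ j * s ^ (i - j)" using False that by (simp add: power_add[symmetric])
        then show ?thesis using s by (simp add: mult.assoc[symmetric] power_inverse)
      qed
      then have "z * s ^ i = (\<Sum>j<l. of_int (d j) * s ^ (i - j))"
        unfolding d sum_distrib_right by (intro sum.cong) (simp_all add: mult.assoc)
      also have "\<dots> \<in> gspan ?S (\<lambda>i. s ^ i) ?I"
        using i by (intro gspan_sum base) auto
      finally show ?thesis
        using z(2) by (intro bexI[of _ "z * s ^ i"]) (simp_all add: mult.assoc[symmetric])
    qed
  qed (use unital_subring_range_of_int in auto)
qed

lemma finite_range_of_int:
  assumes "k > 0" "of_nat k = (0::'a::ring_1)"
  shows "finite (range (of_int :: int \<Rightarrow> 'a))"
proof (rule finite_subset)
  show "range (of_int :: int \<Rightarrow> 'a) \<subseteq> of_int ` {0..<int k}"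
  proof (rule image_subsetI)
    fix c :: int
    have "(of_int c :: 'a) = of_int (int k * (c div int k) + c mod int k)" by simp
    also have "\<dots> = of_int (c mod int k)"
      unfolding of_int_add of_int_mult using assms(2) by simp
    finally show "(of_int c :: 'a) \<in> of_int ` {0..<int k}"
      by (rule image_eqI) (use assms(1) in simp)
  qed
qed simp

text \<open>
  A relation \<open>s f(s) = 1\<close> is a monic equation for \<open>1/s\<close> over the finite prime field, so
  \<open>1/s\<close> has finitely many powers.
\<close>

lemma torsion_of_inverse_int_poly_value:
  fixes s :: "'a::division_ring"
  assumes char: "k > 0" "of_nat k = (0::'a)"
    and x: "x \<in> int_poly_values s" "s * x = 1"
  obtains n where "n > 0" "s ^ n = 1"
proof -
  obtain l :: nat and c :: "nat \<Rightarrow> int" where c: "x = (\<Sum>i<l. of_int (c i) * s ^ i)"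
    by (rule int_poly_values_expand[OF x(1)])
  have s: "s \<noteq> 0" using x(2) by auto
  define t where "t = inverse s"
  have t: "t \<noteq> 0" using s by (simp add: t_def)
  have xt: "x = t" using x(2) by (simp add: t_def inverse_unique)
  let ?S = "range (of_int :: int \<Rightarrow> 'a)"
  interpret unital_subring ?S by (rule unital_subring_range_of_int)
  let ?V = "gspan ?S (\<lambda>i. t ^ i) {..<Suc l}"
  have st: "s ^ i * t ^ l = t ^ (l - i)" if "i < l" for i
  proof -
    have "t ^ l = t ^ i * t ^ (l - i)" using that by (simp add: power_add[symmetric])
    then show ?thesis using s by (simp add: mult.assoc[symmetric] t_def power_inverse)
  qed
  have rel: "t ^ Suc l \<in> ?V"
  proof -
    have "t ^ Suc l = x * t ^ l" using xt by simp
    also have "\<dots> = (\<Sum>i<l. of_int (c i) * t ^ (l - i))"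
      unfolding c sum_distrib_right using st by (intro sum.cong) (simp_all add: mult.assoc)
    also have "\<dots> \<in> ?V"
    proof (intro gspan_sum gspan_scale)
      fix i assume "i \<in> {..<l}"
      then show "t ^ (l - i) \<in> ?V" using gspan_base[of "{..<Suc l}" "l - i" "\<lambda>i. t ^ i"] by simp
    qed auto
    finally show ?thesis .
  qed
  have step: "t * v \<in> ?V" if "v \<in> ?V" for v
  proof (rule gspan_left_mult[OF _ _ that])
    show "t * r = r * t" if "r \<in> ?S" for r using that by (auto simp: mult_of_int_commute)
    fix i assume i: "i \<in> {..<Suc l}"
    show "t * t ^ i \<in> ?V"
    proof (cases "i = l")
      case False
      then show ?thesis using i gspan_base[of "{..<Suc l}" "Suc i" "\<lambda>i. t ^ i"] by simp
    qed (use rel in simp)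
  qed
  have pow: "t ^ n \<in> ?V" for n
  proof (induction n)
    case 0
    show ?case using gspan_base[of "{..<Suc l}" 0 "\<lambda>i. t ^ i"] by simp
  qed (use step in simp)
  have "finite ?V" by (rule finite_gspan[OF finite_range_of_int[OF char]]) simp
  then have "finite (range (\<lambda>n::nat. t ^ n))"
    by (rule finite_subset[rotated]) (use pow in auto)
  then obtain n where n: "n > 0" "t ^ n = 1" using finite_powers_torsion[OF _ t] by blast
  have "s ^ n * t ^ n = 1" unfolding t_def power_inverse using s by simp
  then show thesis using that[of n] n by simp
qed

section \<open>The contradiction in positive characteristic and in characteristic 0\<close>

lemma normalized_torsion_int_poly_values:
  fixes a y :: "'a::division_ring"
  assumes "n > 0" "a ^ n = 1" "y * a = a ^ e * y" "m > 0" "y ^ m * a = a * y ^ m"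
  shows "normalized_torsion a y n e m (int_poly_values (y ^ m))"
proof (intro normalized_torsion.intro assms int_poly_values_base unital_subring_int_poly_values)
  fix r assume r: "r \<in> int_poly_values (y ^ m)"
  show "r * t = t * r" if "t \<in> int_poly_values (y ^ m)" for t
    using r that by (rule int_poly_values_commutative)
  show "a * r = r * a" "y * r = r * y"
    using int_poly_values_commute[OF assms(5) r] int_poly_values_commute[OF power_commutes r] by simp_all
qed

text \<open>For \<open>s = y ^ m\<close> of infinite order, an inverse of \<open>s\<close> among its
  own polynomial values would make \<open>s\<close> torsion, so \<open>s\<close> serves as
  \<open>w\<close>. The prime \<open>l\<close> is nonzero in the ring by
  \<open>no_torsion_of_char_order\<close>, hence coprime to the characteristic, and the latter is
  \<open>s * 0\<close>.\<close>

lemma normalized_torsion_char_pos: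
  fixes a y :: "'a::division_ring"
  assumes char: "k > 0" "of_nat k = (0::'a)"
    and a: "n > 0" "a ^ n = 1" "y * a = a ^ e * y" "y * a \<noteq> a * y"
    and tors: "\<And>v. v \<noteq> 0 \<Longrightarrow> \<exists>k>0. (a * v * inverse a * inverse v) ^ k = 1"
  shows False
proof -
  have y: "y \<noteq> 0" using a(4) by auto
  obtain m where m: "m > 0" "y ^ m * a = a * y ^ m"
    using normalizing_power_commutes[OF a(1-3) y] .
  have CHAR: "CHAR('a) > 0" using char CHAR_pos_iff by blast
  show False
  proof (cases "\<exists>r>0. (y ^ m) ^ r = 1")
    case True
    then obtain r where r: "r > 0" "y ^ (m * r) = 1" by (auto simp: power_mult)
    \<comment> \<open>Enlarging \<open>m\<close> to \<open>m * r\<close> turns \<open>y ^ m\<close>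
      into 1, so the finite prime ring can serve as coefficient ring and \<open>B\<close> becomes
      finite.\<close>
    interpret normalized_torsion a y n e "m * r" "range of_int"
    proof (intro normalized_torsion.intro a unital_subring_range_of_int)
      show "0 < m * r" using m r by simp
      show "y ^ (m * r) \<in> range of_int" using r(2) by (metis of_int_1 rangeI)
    qed (metis imageE mult_of_int_commute)+
    show False
      using finite_subring_commutative[OF B.unital_subring_axioms finite_B[OF finite_range_of_int[OF char]]
          y_mem a_mem] a(4) by blast
  next
    case False
    let ?s = "y ^ m"
    have nt: "normalized_torsion a y n e m (int_poly_values ?s)"
      by (rule normalized_torsion_int_poly_values[OF a(1-3) m])
    interpret normalized_torsion_nonunit a y n e m "int_poly_values ?s" ?s
    proof (intro normalized_torsion_nonunit.intro nt normalized_torsion_nonunit_axioms.intro)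
      show "?s * x \<noteq> 1" if "x \<in> int_poly_values ?s" for x
        using torsion_of_inverse_int_poly_value[OF char that] False by blast
    qed (use y int_poly_values_base in auto)
    obtain l z u where l: "prime l" "z \<in> Loc" "z \<noteq> 0" "(1 + ?s * z) ^ l = 1"
      "u \<in> Loc" "of_nat l = ?s * u"
      using torsion_commutator[OF a(4) tors] .
    have "of_nat l \<noteq> (0::'a)"
      using no_torsion_of_char_order[OF l(1) _ l(4)] l(3) y by auto
    have "coprime l CHAR('a)"
    proof (rule ccontr)
      assume "\<not> coprime l CHAR('a)"
      then have "l dvd CHAR('a)" using prime_imp_coprime[OF l(1)] by blast
      then obtain j where j: "CHAR('a) = l * j" by (auto elim: dvdE)
      have "of_nat l * of_nat j = (0::'a)" using of_nat_CHAR[where ?'a = 'a] unfolding j by simp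
      then have "of_nat j = (0::'a)" using \<open>of_nat l \<noteq> 0\<close> by simp
      then have "CHAR('a) dvd j" by (simp add: of_nat_eq_0_iff_char_dvd)
      moreover have "j > 0" "j < CHAR('a)" using CHAR prime_gt_1_nat[OF l(1)] unfolding j by auto
      ultimately show False by (auto dest: dvd_imp_le)
    qed
    then show False using of_nat_coprime[OF _ l(6) _ l(5) Loc.zero_mem, of "CHAR('a)"] by simp
  qed
qed

text \<open>For \<open>l \<noteq> 3\<close> the coprime integers \<open>l\<close> and 3 are both
  multiples of 3 in \<open>Loc\<close>. For \<open>l = 3\<close> and \<open>t = 3 * z\<close>, the
  vanishing sum \<open>1 + (1 + t) + (1 + t) ^ 2\<close> equals \<open>3 * (1 + t + z * t)\<close>;
  cancelling 3 exhibits \<open>- z - z * z\<close> as an inverse of 3.\<close>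

lemma normalized_torsion_nonunit_3:
  fixes a y :: "'a::division_ring"
  assumes "normalized_torsion_nonunit a y n e m S 3"
    and nc: "y * a \<noteq> a * y"
    and tors: "\<And>v. v \<noteq> 0 \<Longrightarrow> \<exists>k>0. (a * v * inverse a * inverse v) ^ k = 1"
  shows False
proof -
  interpret normalized_torsion_nonunit a y n e m S 3 by fact
  obtain l z u where l: "prime l" "z \<in> Loc" "z \<noteq> 0" "(1 + 3 * z) ^ l = 1"
    "u \<in> Loc" "of_nat l = 3 * u"
    using torsion_commutator[OF nc tors] .
  show False
  proof (cases "l = 3")
    case True
    have "1 + 3 * z \<noteq> 1" using l(3) w(2) by simp
    then have "(\<Sum>j<l. (1 + 3 * z) ^ j) = 0" using geometric_sum_eq_0[OF l(4)] by blast
    then have sum0: "1 + (1 + 3 * z) + (1 + 3 * z) * (1 + 3 * z) = 0"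
      unfolding True by (simp add: numeral_3_eq_3)
    have triple: "3 * t = t + t + t" for t :: 'a
    proof -
      have "3 = 1 + 1 + (1::'a)" by simp
      then have "3 * t = (1 + 1 + 1) * t" by (rule arg_cong)
      then show ?thesis by (simp only: distrib_right mult_1_left)
    qed
    define t where "t = 3 * z"
    have "3 * (1 + t + z * t) = (1 + 1 + 1) + (t + t + t) + t * t"
      unfolding distrib_left mult.assoc[symmetric] t_def[symmetric] triple[of t] triple[of 1]
      by simp
    also have "\<dots> = 1 + (1 + t) + (1 + t) * (1 + t)" by (simp add: distrib_left distrib_right add_ac)
    finally have "3 * (1 + t + z * t) = 0" using sum0 by (simp add: t_def)
    then have "1 + t + z * t = 0" using w(2) by (metis mult_eq_0_iff)
    moreover have "z * t = 3 * (z * z)"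
      using mult_of_nat_commute[of 3 z] unfolding t_def mult.assoc[symmetric] by simp
    ultimately have "1 + 3 * z + 3 * (z * z) = 0" by (simp add: t_def)
    then have "1 = - (3 * z + 3 * (z * z))" by (simp only: eq_neg_iff_add_eq_0 add.assoc)
    then have "3 * (- z - z * z) = 1" by (simp add: right_diff_distrib)
    moreover have "- z - z * z \<in> Loc" using l(2) by (intro Loc.diff_mem Loc.uminus_mem Loc.mult_mem)
    ultimately show False using w_nonunit_Loc by blast
  next
    case False
    have "coprime l 3" using primes_coprime[OF l(1) _ False] by simp
    then show False using of_nat_coprime[OF _ l(6) _ l(5) Loc.one_mem, of 3] by simp
  qed
qed

lemma normalized_torsion_char_0:
  fixes a y :: "'a::division_ring"
  assumes char: "\<And>k. k > 0 \<Longrightarrow> of_nat k \<noteq> (0::'a)"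
    and a: "n > 0" "a ^ n = 1" "y * a = a ^ e * y" "y * a \<noteq> a * y"
    and tors: "\<And>v. v \<noteq> 0 \<Longrightarrow> \<exists>k>0. (a * v * inverse a * inverse v) ^ k = 1"
  shows False
proof -
  have y: "y \<noteq> 0" using a(4) by auto
  obtain m where m: "m > 0" "y ^ m * a = a * y ^ m"
    using normalizing_power_commutes[OF a(1-3) y] .
  let ?s = "y ^ m"
  have three: "(3::'a) \<noteq> 0" using char[of 3] by simp
  have inv3: "of_int 3 * of_int c \<noteq> (1::'a)" for c :: int
  proof
    assume "of_int 3 * of_int c = (1::'a)"
    then have "of_int (3 * c - 1) = (0::'a)" by simp
    then have "of_nat (nat \<bar>3 * c - 1\<bar>) = (0::'a)"
      by (cases "3 * c - 1 \<ge> 0") (simp_all add: abs_if)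
    then have "3 * c - 1 = 0" using char[of "nat \<bar>3 * c - 1\<bar>"] by auto
    then show False by presburger
  qed
  \<comment> \<open>The integer 3 can be a unit of the first ring, as in the integers with 1/3
    adjoined, but then not of the second, which is the coefficient ring belonging to
    \<open>inverse y\<close>.\<close>
  consider "\<And>x. x \<in> int_poly_values ?s \<Longrightarrow> 3 * x \<noteq> 1"
    | "\<And>x. x \<in> int_poly_values (inverse ?s) \<Longrightarrow> 3 * x \<noteq> 1"
    using not_both_invert_int[of ?s 3] inv3 y by force
  then show False
  proof cases
    case 1
    have "normalized_torsion_nonunit a y n e m (int_poly_values ?s) 3"
      using 1 three int_poly_values_of_int[of 3]
      by (intro normalized_torsion_nonunit.intro normalized_torsion_nonunit_axioms.intro
          normalized_torsion_int_poly_values a m) auto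
    then show False using a(4) tors by (rule normalized_torsion_nonunit_3)
  next
    case 2
    let ?y = "inverse y"
    \<comment> \<open>As \<open>y ^ m\<close> commutes with \<open>a\<close>,
      \<open>y ^ (m - 1)\<close> conjugates \<open>a\<close> as \<open>inverse y\<close> does. This
      supplies a natural exponent for \<open>inverse y\<close>.\<close>
    have E: "y ^ (m - 1) * a = a ^ (e ^ (m - 1)) * y ^ (m - 1)"
      using conj_power_rel[OF a(3), of "m - 1" 1] by simp
    have ym: "y ^ m = y * y ^ (m - 1)" using m(1) by (cases m) auto
    have "(a * y) * y ^ (m - 1) = y * (y ^ (m - 1) * a)"
      using m(2) unfolding ym by (simp add: mult.assoc)
    also have "\<dots> = (y * a ^ (e ^ (m - 1))) * y ^ (m - 1)" unfolding E by (simp add: mult.assoc)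
    finally have ay: "a * y = y * a ^ (e ^ (m - 1))" using y by simp
    have "?y * a = ?y * (a * y) * ?y" using y by (simp add: mult.assoc)
    also have "\<dots> = a ^ (e ^ (m - 1)) * ?y" unfolding ay using y by (simp add: mult.assoc[symmetric])
    finally have rel: "?y * a = a ^ (e ^ (m - 1)) * ?y" .
    have nc: "?y * a \<noteq> a * ?y"
      using commute_inverse[of a ?y] a(4) by auto
    have com: "?y ^ m * a = a * ?y ^ m"
      using commute_inverse[OF m(2)[symmetric]] by (simp add: power_inverse)
    have "normalized_torsion_nonunit a ?y n (e ^ (m - 1)) m (int_poly_values (?y ^ m)) 3"
      using 2 three int_poly_values_of_int[of 3]
      by (intro normalized_torsion_nonunit.intro normalized_torsion_nonunit_axioms.intro
          normalized_torsion_int_poly_values a m rel com) (auto simp: power_inverse)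
    then show False using nc tors by (rule normalized_torsion_nonunit_3)
  qed
qed

text \<open>The hypothesis \<open>tors\<close> records what normality provides: for \<open>a\<close>
  in a periodic normal subgroup, its commutator with any \<open>v\<close> stays in that
  subgroup.\<close>

theorem torsion_commutators_central:
  fixes a :: "'a::division_ring"
  assumes "k > 0" "a ^ k = 1"
    and tors: "\<And>v. v \<noteq> 0 \<Longrightarrow> \<exists>k>0. (a * v * inverse a * inverse v) ^ k = 1"
  shows "a * x = x * a"
proof (rule ccontr)
  assume "a * x \<noteq> x * a"
  then have nc: "x * a \<noteq> a * x" by simp
  obtain n where n: "n > 0" "a ^ n = 1" "\<And>j. 0 < j \<Longrightarrow> j < n \<Longrightarrow> a ^ j \<noteq> 1"
    "of_nat n \<noteq> (0::'a)" using torsion_order[OF assms(2,1)] by metis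
  obtain y e where y: "y * a = a ^ e * y" "y * a \<noteq> a * y"
    using normalize_torsion[OF n nc] by metis
  show False
    using normalized_torsion_char_pos[OF _ _ n(1,2) y tors]
      normalized_torsion_char_0[OF _ n(1,2) y tors] by blast
qed

section \<open>The periodic radical and ascendant subgroups\<close>

text \<open>
  Subgroups and normal subgroups of the multiplicative group of a division ring are handled as plain
  sets; closure of \<open>N\<close> under inverses is automatic, since its elements are torsion.
\<close>

definition periodic_normal :: "'a::division_ring set \<Rightarrow> 'a set \<Rightarrow> bool"
  where "periodic_normal H N \<longleftrightarrow> N \<subseteq> H \<and> 1 \<in> N \<and> (\<forall>x\<in>N. \<forall>y\<in>N. x * y \<in> N) \<and>
    (\<forall>h\<in>H. \<forall>x\<in>N. h * x * inverse h \<in> N) \<and> (\<forall>x\<in>N. \<exists>k>0. x ^ k = 1)"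

text \<open>The union is already closed under products, because
  \<open>periodic_normal_product\<close> makes the family directed.\<close>

definition periodic_radical :: "'a::division_ring set \<Rightarrow> 'a set"
  where "periodic_radical H = \<Union> {N. periodic_normal H N}"

definition mult_subgroup :: "'a::division_ring set \<Rightarrow> bool"
  where "mult_subgroup H \<longleftrightarrow> 0 \<notin> H \<and> 1 \<in> H \<and> (\<forall>x\<in>H. \<forall>y\<in>H. x * y \<in> H) \<and> (\<forall>x\<in>H. inverse x \<in> H)"

lemma periodic_normal_inverse:
  assumes "periodic_normal H N" "x \<in> N"
  shows "inverse x \<in> N"
proof -
  obtain k where k: "k > 0" "x ^ k = 1" using assms by (auto simp: periodic_normal_def)
  have "x ^ j \<in> N" for j
    using assms by (induction j) (auto simp: periodic_normal_def)
  then show ?thesis using torsion_inverse[OF k(2,1)] by simp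
qed

text \<open>Modulo \<open>N\<close> the power \<open>(x * y) ^ k\<close> is \<open>x ^ k\<close>;
  choosing \<open>k\<close> with \<open>x ^ k = 1\<close> leaves an element of \<open>N\<close>,
  which is torsion.\<close>

lemma periodic_normal_product:
  assumes H: "mult_subgroup H" and M: "periodic_normal H M" and N: "periodic_normal H N"
  shows "periodic_normal H {x * y |x y. x \<in> M \<and> y \<in> N}" (is "periodic_normal H ?P")
proof -
  have H': "0 \<notin> H" "\<And>x y. x \<in> H \<Longrightarrow> y \<in> H \<Longrightarrow> x * y \<in> H" "\<And>x. x \<in> H \<Longrightarrow> inverse x \<in> H"
    using H by (auto simp: mult_subgroup_def)
  have M': "M \<subseteq> H" "1 \<in> M" "\<And>x y. x \<in> M \<Longrightarrow> y \<in> M \<Longrightarrow> x * y \<in> M"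
    "\<And>h x. h \<in> H \<Longrightarrow> x \<in> M \<Longrightarrow> h * x * inverse h \<in> M" "\<And>x. x \<in> M \<Longrightarrow> \<exists>k>0. x ^ k = 1"
    using M by (auto simp: periodic_normal_def)
  have N': "N \<subseteq> H" "1 \<in> N" "\<And>x y. x \<in> N \<Longrightarrow> y \<in> N \<Longrightarrow> x * y \<in> N"
    "\<And>h x. h \<in> H \<Longrightarrow> x \<in> N \<Longrightarrow> h * x * inverse h \<in> N" "\<And>x. x \<in> N \<Longrightarrow> \<exists>k>0. x ^ k = 1"
    using N by (auto simp: periodic_normal_def)
  have swap: "inverse x * y * x \<in> N" if "x \<in> H" "y \<in> N" for x y
    using N'(4)[OF H'(3)[OF that(1)] that(2)] by simp
  have nz: "x \<noteq> 0" if "x \<in> H" for x using that H'(1) by auto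
  show ?thesis
    unfolding periodic_normal_def
  proof (intro conjI ballI)
    show "?P \<subseteq> H" using M'(1) N'(1) H'(2) by auto
    show "1 \<in> ?P" using M'(2) N'(2) by (intro CollectI exI[of _ 1] conjI) simp_all
    fix p assume "p \<in> ?P"
    then obtain x y where p: "x \<in> M" "y \<in> N" "p = x * y" by blast
    have x: "x \<in> H" and y: "y \<in> H" using p(1,2) M'(1) N'(1) by auto
    note x = x nz[OF x] and y = y nz[OF y]
    show "\<exists>k>0. p ^ k = 1"
    proof -
      have pow: "\<exists>z\<in>N. p ^ j = x ^ j * z" for j
      proof (induction j)
        case 0
        then show ?case using N'(2) by (intro bexI[of _ 1]) auto
      next
        case (Suc j)
        then obtain z where z: "z \<in> N" "p ^ j = x ^ j * z" by blast
        have "p ^ Suc j = p ^ j * p" by (rule power_Suc2)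
        also have "\<dots> = (x ^ j * z) * (x * y)" unfolding z(2) unfolding p(3) ..
        also have "\<dots> = x ^ j * x * (inverse x * z * x * y)"
          using x by (simp add: mult.assoc inverse_cancel)
        also have "\<dots> = x ^ Suc j * (inverse x * z * x * y)" by (simp only: power_Suc2)
        finally show ?case using N'(3)[OF swap[OF x(1) z(1)] p(2)] by (rule bexI)
      qed
      obtain k where k: "k > 0" "x ^ k = 1" using M'(5)[OF p(1)] by blast
      then obtain z where "z \<in> N" "p ^ k = z" using pow[of k] by auto
      then obtain l where "l > 0" "(p ^ k) ^ l = 1" using N'(5) by blast
      then show ?thesis using k by (intro exI[of _ "k * l"]) (simp add: power_mult)
    qed
    show "h * p * inverse h \<in> ?P" if "h \<in> H" for h
    proof -
      have "h * p * inverse h = (h * x * inverse h) * (h * y * inverse h)"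
        unfolding p(3) using nz[OF that] by (simp add: mult.assoc inverse_cancel)
      then show ?thesis
        using M'(4)[OF that p(1)] N'(4)[OF that p(2)] by (intro CollectI exI conjI)
    qed
    show "p * q \<in> ?P" if "q \<in> ?P" for q
    proof -
      from that obtain u v where q: "u \<in> M" "v \<in> N" "q = u * v" by blast
      have u: "u \<in> H" using q(1) M'(1) by auto
      note u = u nz[OF u]
      have "p * q = (x * u) * ((inverse u * y * u) * v)"
        unfolding p(3) q(3) using u by (simp add: mult.assoc inverse_cancel)
      moreover have "x * u \<in> M" using M'(3) p(1) q(1) .
      moreover have "(inverse u * y * u) * v \<in> N" using N'(3)[OF swap[OF u(1) p(2)] q(2)] .
      ultimately show ?thesis by (intro CollectI exI conjI)
    qed
  qed
qed

lemma periodic_normal_trivial: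
  assumes "mult_subgroup H"
  shows "periodic_normal H {1}"
proof -
  have "h * inverse h = 1" if "h \<in> H" for h
    using assms that by (intro right_inverse) (auto simp: mult_subgroup_def)
  then show ?thesis using assms by (simp add: mult_subgroup_def periodic_normal_def gt_ex)
qed

lemma periodic_radicalI: "periodic_normal H N \<Longrightarrow> x \<in> N \<Longrightarrow> x \<in> periodic_radical H"
  unfolding periodic_radical_def by blast

lemma periodic_radicalE:
  assumes "x \<in> periodic_radical H"
  obtains N where "periodic_normal H N" "x \<in> N"
  using assms unfolding periodic_radical_def by blast

lemma periodic_normal_radical:
  assumes H: "mult_subgroup H"
  shows "periodic_normal H (periodic_radical H)"
  unfolding periodic_normal_def
proof (intro conjI ballI)
  show "1 \<in> periodic_radical H" by (rule periodic_radicalI[OF periodic_normal_trivial[OF H]]) simp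
next
  show "periodic_radical H \<subseteq> H" unfolding periodic_radical_def periodic_normal_def by blast
next
  fix x assume "x \<in> periodic_radical H"
  then obtain M where M: "periodic_normal H M" "x \<in> M" by (rule periodic_radicalE)
  show "\<exists>k>0. x ^ k = 1" using M unfolding periodic_normal_def by blast
  show "h * x * inverse h \<in> periodic_radical H" if "h \<in> H" for h
  proof (rule periodic_radicalI[OF M(1)])
    show "h * x * inverse h \<in> M" using M that unfolding periodic_normal_def by blast
  qed
  fix y assume "y \<in> periodic_radical H"
  then obtain N where N: "periodic_normal H N" "y \<in> N" by (rule periodic_radicalE)
  show "x * y \<in> periodic_radical H"
    using M(2) N(2) by (intro periodic_radicalI[OF periodic_normal_product[OF H M(1) N(1)]]) blast
qed

text \<open>Conjugation by an element of \<open>K\<close> permutes the periodic normal subgroups of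
  \<open>H\<close>, so it preserves their union; the radical of \<open>H\<close> is thus itself a
  periodic normal subgroup of \<open>K\<close>.\<close>

lemma periodic_radical_normal_subset:
  assumes H: "mult_subgroup H" and K: "mult_subgroup K" and "H \<subseteq> K"
    and norm: "\<And>g h. g \<in> K \<Longrightarrow> h \<in> H \<Longrightarrow> g * h * inverse g \<in> H"
  shows "periodic_radical H \<subseteq> periodic_radical K"
proof (intro subsetI periodic_radicalI)
  have R: "periodic_normal H (periodic_radical H)" by (rule periodic_normal_radical[OF H])
  have conj: "g * x * inverse g \<in> periodic_radical H"
    if g: "g \<in> K" and x: "x \<in> periodic_radical H" for g x
  proof -
    have g0: "g \<noteq> 0" "inverse g \<in> K" using g K by (auto simp: mult_subgroup_def)
    obtain N where N: "periodic_normal H N" "x \<in> N" using x by (rule periodic_radicalE)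
    then have N': "N \<subseteq> H" "1 \<in> N" "\<And>x y. x \<in> N \<Longrightarrow> y \<in> N \<Longrightarrow> x * y \<in> N"
      "\<And>h x. h \<in> H \<Longrightarrow> x \<in> N \<Longrightarrow> h * x * inverse h \<in> N" "\<And>x. x \<in> N \<Longrightarrow> \<exists>k>0. x ^ k = 1"
      by (auto simp: periodic_normal_def)
    let ?c = "\<lambda>x. g * x * inverse g"
    have mult: "?c x * ?c y = ?c (x * y)" for x y
      using g0 by (simp add: mult.assoc inverse_cancel)
    have pow: "?c x ^ k = ?c (x ^ k)" for x k
      using g0 mult by (induction k) simp_all
    have "periodic_normal H (?c ` N)"
      unfolding periodic_normal_def
    proof (intro conjI ballI)
      show "?c ` N \<subseteq> H" using norm[OF g] N'(1) by auto
      show "1 \<in> ?c ` N" using g0 N'(2) by (intro image_eqI[of _ _ 1]) auto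
      fix p assume "p \<in> ?c ` N"
      then obtain x where x: "x \<in> N" "p = ?c x" by blast
      obtain k where "k > 0" "x ^ k = 1" using N'(5)[OF x(1)] by blast
      then have "p ^ k = 1" unfolding x(2) pow using g0 by simp
      then show "\<exists>k>0. p ^ k = 1" using \<open>k > 0\<close> by blast
      show "p * q \<in> ?c ` N" if "q \<in> ?c ` N" for q
        using that N'(3)[OF x(1)] mult unfolding x(2) by (auto intro!: imageI)
      show "h * p * inverse h \<in> ?c ` N" if h: "h \<in> H" for h
      proof -
        \<comment> \<open>Conjugating \<open>?c x\<close> by \<open>h\<close> is the same as
          applying \<open>?c\<close> after conjugating \<open>x\<close> by \<open>?h\<close>, and
          \<open>?h\<close> is in \<open>H\<close> by normality.\<close>
        let ?h = "inverse g * h * g"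
        have "?h \<in> H" using norm[OF g0(2) h] by simp
        then have "?h * x * inverse ?h \<in> N" using N'(4) x(1) by blast
        moreover have "h \<noteq> 0" using h H by (auto simp: mult_subgroup_def)
        then have "h * p * inverse h = ?c (?h * x * inverse ?h)"
          unfolding x(2) using g0 by (simp add: nonzero_inverse_mult_distrib mult.assoc inverse_cancel)
        ultimately show ?thesis by blast
      qed
    qed
    then show ?thesis using N(2) by (intro periodic_radicalI[of _ "?c ` N"] imageI)
  qed
  then show "periodic_normal K (periodic_radical H)"
    using R \<open>H \<subseteq> K\<close> unfolding periodic_normal_def by blast
qed

text \<open>The radicals form a chain along with the groups, so any two elements to be multiplied or
  conjugated meet at the index \<open>max i j\<close>; hence the union of the radicals is periodic
  and normal in the union of the groups.\<close>

lemma periodic_radical_union: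
  fixes F :: "'i::linorder \<Rightarrow> 'a::division_ring set"
  assumes F: "\<And>i. i \<in> I \<Longrightarrow> mult_subgroup (F i)" and "I \<noteq> {}"
    and mono: "\<And>i j. i \<in> I \<Longrightarrow> j \<in> I \<Longrightarrow> i \<le> j \<Longrightarrow> F i \<subseteq> F j"
    and rad: "\<And>i j. i \<in> I \<Longrightarrow> j \<in> I \<Longrightarrow> i \<le> j \<Longrightarrow> periodic_radical (F i) \<subseteq> periodic_radical (F j)"
    and "i \<in> I"
  shows "periodic_radical (F i) \<subseteq> periodic_radical (\<Union>i\<in>I. F i)"
proof -
  let ?R = "\<lambda>i. periodic_radical (F i)"
  have R: "periodic_normal (F i) (?R i)" if "i \<in> I" for i
    using periodic_normal_radical F that by blast
  have "periodic_normal (\<Union>i\<in>I. F i) (\<Union>i\<in>I. ?R i)"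
    unfolding periodic_normal_def
  proof (intro conjI ballI)
    show "(\<Union>i\<in>I. ?R i) \<subseteq> (\<Union>i\<in>I. F i)" using R by (fastforce simp: periodic_normal_def)
    show "1 \<in> (\<Union>i\<in>I. ?R i)" using R \<open>i \<in> I\<close> by (auto simp: periodic_normal_def)
    fix x assume "x \<in> (\<Union>i\<in>I. ?R i)"
    then obtain i where i: "i \<in> I" "x \<in> ?R i" by blast
    show "\<exists>k>0. x ^ k = 1" using R[OF i(1)] i(2) by (auto simp: periodic_normal_def)
    show "x * y \<in> (\<Union>i\<in>I. ?R i)" if y: "y \<in> (\<Union>i\<in>I. ?R i)" for y
    proof -
      obtain j where j: "j \<in> I" "y \<in> ?R j" using y by blast
      have "max i j \<in> I" using i j by (simp add: max_def)
      moreover have "x \<in> ?R (max i j)" "y \<in> ?R (max i j)"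
        using rad[OF i(1), of "max i j"] rad[OF j(1), of "max i j"] i j \<open>max i j \<in> I\<close> by auto
      ultimately have "x * y \<in> ?R (max i j)"
        using R[of "max i j"] unfolding periodic_normal_def by blast
      then show ?thesis using \<open>max i j \<in> I\<close> by (rule UN_I[rotated])
    qed
    show "h * x * inverse h \<in> (\<Union>i\<in>I. ?R i)" if h: "h \<in> (\<Union>i\<in>I. F i)" for h
    proof -
      obtain j where j: "j \<in> I" "h \<in> F j" using h by blast
      have "max i j \<in> I" using i j by (simp add: max_def)
      moreover have "x \<in> ?R (max i j)" "h \<in> F (max i j)"
        using rad[OF i(1), of "max i j"] mono[OF j(1), of "max i j"] i j \<open>max i j \<in> I\<close> by auto
      ultimately have "h * x * inverse h \<in> ?R (max i j)"
        using R[of "max i j"] unfolding periodic_normal_def by blast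
      then show ?thesis using \<open>max i j \<in> I\<close> by (rule UN_I[rotated])
    qed
  qed
  from periodic_radicalI[OF this] show ?thesis using \<open>i \<in> I\<close> by blast
qed

section \<open>Translation from \<open>nonzero_group\<close> to plain sets\<close>

lemma nonzero_group_simps:
  "carrier nonzero_group = UNIV - {0}"
  "x \<otimes>\<^bsub>nonzero_group\<^esub> y = x * y"
  "\<one>\<^bsub>nonzero_group\<^esub> = 1"
  by (simp_all add: nonzero_group_def)

lemma inv_nonzero_group: "x \<noteq> 0 \<Longrightarrow> inv\<^bsub>nonzero_group\<^esub> x = inverse x"
  for x :: "'a::division_ring"
  by (rule group.inv_equality[OF group_nonzero_group]) (auto simp: nonzero_group_simps)

lemma subgroup_nonzero_group:
  assumes "subgroup H (nonzero_group :: 'a::division_ring monoid)"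
  shows "mult_subgroup H"
proof -
  interpret subgroup H "nonzero_group :: 'a monoid" by fact
  have "0 \<notin> H" using subset by (auto simp: nonzero_group_simps)
  then show ?thesis
    unfolding mult_subgroup_def
    using m_closed one_closed m_inv_closed by (metis inv_nonzero_group nonzero_group_simps(2,3))
qed

lemma normal_nonzero_group:
  assumes K: "subgroup K (nonzero_group :: 'a::division_ring monoid)"
    and N: "H \<lhd> (nonzero_group :: 'a monoid)\<lparr>carrier := K\<rparr>"
  shows "H \<subseteq> K" "g \<in> K \<Longrightarrow> h \<in> H \<Longrightarrow> g * h * inverse g \<in> H"
proof -
  show "H \<subseteq> K" using normal_imp_subgroup[OF N] subgroup.subset by fastforce
  assume g: "g \<in> K" and h: "h \<in> H"
  have "g \<noteq> 0" using subgroup_nonzero_group[OF K] g by (auto simp: mult_subgroup_def)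
  then have "inv\<^bsub>nonzero_group\<lparr>carrier := K\<rparr>\<^esub> g = inverse g"
    using group.m_inv_consistent[OF group_nonzero_group K g] inv_nonzero_group by simp
  then show "g * h * inverse g \<in> H"
    using normal.inv_op_closed2[OF N, of g h] g h by (simp add: nonzero_group_simps)
qed

lemma pow_nonzero_group: "x [^]\<^bsub>nonzero_group\<lparr>carrier := G\<rparr>\<^esub> (n::nat) = x ^ n"
  for x :: "'a::division_ring"
proof (induction n)
  case (Suc n)
  have "x [^]\<^bsub>nonzero_group\<lparr>carrier := G\<rparr>\<^esub> Suc n = x [^]\<^bsub>nonzero_group\<lparr>carrier := G\<rparr>\<^esub> n * x"
    by (simp add: nat_pow_def nonzero_group_simps)
  then show ?case using Suc by (simp add: power_commutes)
qed (simp add: nat_pow_def nonzero_group_simps)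

text \<open>Transfinite induction on \<open>\<beta>\<close>. Monotonicity of \<open>F\<close> is
  carried along because the limit step needs it.\<close>

lemma ascendant_series_radical:
  fixes F :: "'i::wellorder \<Rightarrow> 'a::division_ring set"
  assumes asc: "ascendant_series nonzero_group G \<gamma> F"
    and "\<alpha> \<le> \<beta>" "\<beta> \<le> \<gamma>"
  shows "F \<alpha> \<subseteq> F \<beta> \<and> periodic_radical (F \<alpha>) \<subseteq> periodic_radical (F \<beta>)"
  using assms(2,3)
proof (induction \<beta> arbitrary: \<alpha> rule: less_induct)
  case (less \<beta>)
  have sub: "subgroup (F \<delta>) nonzero_group" if "\<delta> \<le> \<gamma>" for \<delta>
    using asc that by (auto simp: ascendant_series_def)
  have F: "mult_subgroup (F \<delta>)" if "\<delta> \<le> \<gamma>" for \<delta>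
    using subgroup_nonzero_group sub that by blast
  show ?case
  proof (cases "\<alpha> = \<beta>")
    case False
    then have lt: "\<alpha> < \<beta>" using less.prems by simp
    show ?thesis
    proof (cases "limit_ordinal \<beta>")
      case True
      then have eq: "F \<beta> = (\<Union>\<delta>\<in>{..<\<beta>}. F \<delta>)"
        using asc less.prems by (auto simp: ascendant_series_def)
      have IH: "F i \<subseteq> F j \<and> periodic_radical (F i) \<subseteq> periodic_radical (F j)"
        if "i \<le> j" "j \<in> {..<\<beta>}" for i j
        using less.IH[of j i] that less.prems by auto
      have "periodic_radical (F \<alpha>) \<subseteq> periodic_radical (\<Union>\<delta>\<in>{..<\<beta>}. F \<delta>)"
        using lt less.prems IH F by (intro periodic_radical_union) auto
      then show ?thesis unfolding eq using lt by auto
    next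
      case False
      \<comment> \<open>Being above \<open>\<alpha>\<close> and not a limit, \<open>\<beta>\<close>
        has an immediate predecessor \<open>\<delta>\<close>, and is the \<open>LEAST\<close>
        element above it used in the successor clause of the series.\<close>
      then obtain \<delta> where \<delta>: "\<delta> < \<beta>" "\<And>\<epsilon>. \<delta> < \<epsilon> \<Longrightarrow> \<beta> \<le> \<epsilon>"
        using lt unfolding limit_ordinal_def by (metis not_le)
      then have "(LEAST \<epsilon>. \<delta> < \<epsilon>) = \<beta>" by (intro Least_equality)
      then have N: "F \<delta> \<lhd> nonzero_group\<lparr>carrier := F \<beta>\<rparr>"
        using asc \<delta>(1) less.prems by (auto simp: ascendant_series_def)
      note norm = normal_nonzero_group[OF sub[OF less.prems(2)] N]
      have "periodic_radical (F \<delta>) \<subseteq> periodic_radical (F \<beta>)"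
        using \<delta>(1) less.prems norm F by (intro periodic_radical_normal_subset) auto
      moreover have "\<alpha> \<le> \<delta>" using \<delta>(2)[of \<alpha>] lt by (metis not_le)
      moreover have "\<delta> \<le> \<gamma>" using \<delta>(1) less.prems(2) by simp
      ultimately show ?thesis using less.IH[OF \<delta>(1), of \<alpha>] norm(1) by blast
    qed
  qed simp
qed

theorem theorem4p1:
  fixes G :: "'a::division_ring set"
  assumes "ascendant TYPE('i::wellorder) G (nonzero_group :: 'a monoid)"
    and "periodic ((nonzero_group :: 'a monoid)\<lparr>carrier := G\<rparr>)"
  shows "G \<subseteq> ring_center"
proof
  fix a assume a: "a \<in> G"
  obtain \<gamma> :: 'i and F where asc: "ascendant_series (nonzero_group :: 'a monoid) G \<gamma> F"
    using assms(1) by (auto simp: ascendant_def)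
  define \<o> :: 'i where "\<o> = (LEAST \<alpha>. True)"
  have le: "\<o> \<le> \<gamma>" unfolding \<o>_def by (rule Least_le) simp
  have F: "F \<o> = G" "F \<gamma> = UNIV - {0}" "subgroup G nonzero_group"
    using asc le by (auto simp: ascendant_series_def \<o>_def nonzero_group_simps)
  have G: "mult_subgroup G" using subgroup_nonzero_group F(3) by blast
  \<comment> \<open>This places \<open>a\<close> in the radical of the bottom term of the series,
    from where it is carried up to the radical of the whole group.\<close>
  have "periodic_normal G G"
    using assms(2) G by (auto simp: periodic_def pow_nonzero_group nonzero_group_simps periodic_normal_def mult_subgroup_def)
  then have "a \<in> periodic_radical (UNIV - {0})"
    using ascendant_series_radical[OF asc le order_refl] periodic_radicalI[OF _ a]
    unfolding F by blast
  moreover have "mult_subgroup (UNIV - {0::'a})" by (auto simp: mult_subgroup_def)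
  then have R: "periodic_normal (UNIV - {0}) (periodic_radical (UNIV - {0::'a}))"
    by (rule periodic_normal_radical)
  let ?R = "periodic_radical (UNIV - {0::'a})"
  have tors: "\<exists>k>0. x ^ k = 1" if "x \<in> ?R" for x
    using R that by (auto simp: periodic_normal_def)
  \<comment> \<open>The commutator is \<open>a\<close> times a conjugate of
    \<open>inverse a\<close>.\<close>
  have "a * v * inverse a * inverse v \<in> ?R" if "v \<noteq> 0" for v
  proof -
    have "v * inverse a * inverse v \<in> ?R"
      using R that periodic_normal_inverse[OF R] \<open>a \<in> ?R\<close> by (auto simp: periodic_normal_def)
    then have "a * (v * inverse a * inverse v) \<in> ?R"
      using R \<open>a \<in> ?R\<close> by (auto simp: periodic_normal_def)
    then show ?thesis by (simp add: mult.assoc)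
  qed
  then have "a * x = x * a" for x
    using torsion_commutators_central tors \<open>a \<in> ?R\<close> by metis
  then show "a \<in> ring_center" by (simp add: ring_center_def)
qed

end
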